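(* Let $n\ge3$, let $x_{k-1},y_{k-1}\in\mathbb{R}^n$ be points, $g\in\mathbb{R}^n$ a nonzero vector, and $\ell,L$ scalars with $L>\ell>0$. Define $\kappa=L/\ell$ and $$w_{k-1}=\frac{\sqrt\kappa}{\sqrt\kappa+1}x_{k-1}+\frac{1}{\sqrt\kappa+1}y_{k-1}.$$ Assume that $\|x_{k-1}-w_{k-1}\|\le\|g\|/L$ and $(x_{k-1}-w_{k-1})^Tg=0$. Let $\mathcal{F}$ be the set of functions $f:\mathbb{R}^n\to\mathbb{R}$ such that $\nabla f$ is $L$-Lipschitz, $f$ is strongly convex with modulus $\ell$, and $\nabla f(w_{k-1})=g$. Define $$q(x,y)=\sup_{f\in\mathcal{F}}\frac{(2/\ell)(f(x)-\min\{f\})+\|y-\mathrm{argmin}\{f\}\|^2}{(2/\ell)(f(x_{k-1})-\min\{f\})+\|y_{k-1}-\mathrm{argmin}\{f\}\|^2}.$$ Define $\mathcal{M}_k=w_{k-1}+\mathrm{span}\{g,x_{k-1}-y_{k-1}\}$. Let $x_k=w_{k-1}-g/L$ and $y_k=x_k+(\sqrt\kappa-1)(x_k-x_{k-1})$ be the vectors computed by the Accelerated Gradient algorithm for this data (which lie in $\mathcal{M}_k$). Then $$q(x_k,y_k)\le1-\kappa^{-1/2}$$ and $$\min\{q(x,y):x,y\in\mathcal{M}_k\}\ge1-\kappa^{-1/2}-O(\kappa^{-1}).$$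
   Context: $\min\{f\}$ and $\mathrm{argmin}\{f\}$ are shorthand for $\min\{f(x):x\in\mathbb{R}^n\}$ and the (unique) minimizer of $f$ over $\mathbb{R}^n$. Strongly convex with modulus $\ell$ means $\ell\|x-y\|^2/2\le f(y)-f(x)-\nabla f(x)^T(y-x)$ for all $x,y$. The term $O(\kappa^{-1})$ denotes a quantity bounded by $C\kappa^{-1}$ with an absolute constant $C$. The index $k$ only labels the given data. *)

theory Defs
  imports "HOL-Analysis.Analysis"
begin

text \<open>
  The constant in the \<open>O\<close>-term must not depend on the dimension \<open>n\<close>, so \<open>n\<close>
  has to be a natural number quantified inside the formula and cannot be a type as in
  \<open>real ^ 'n\<close>. All the Euclidean spaces are therefore realised as the subspaces \<open>Rn n\<close> of one
  ambient inner product space, the finitely supported real sequences with the standard inner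
  product. The lemmas about \<open>Rn n\<close> confirm that it is Euclidean \<open>n\<close>-space.
\<close>

typedef finseq = "{v :: nat \<Rightarrow> real. finite {i. v i \<noteq> 0}}"
  morphisms coord Abs_finseq
  by (rule exI[of _ "\<lambda>_. 0"]) simp

setup_lifting type_definition_finseq

lemma finite_coord [simp]: "finite {i. coord x i \<noteq> 0}"
  using coord[of x] by simp

lemma finseq_eqI: "(\<And>i. coord x i = coord y i) \<Longrightarrow> x = y"
  by (metis coord_inject ext)

instantiation finseq :: real_vector
begin

lift_definition zero_finseq :: finseq is "\<lambda>_. 0" by simp

lift_definition plus_finseq :: "finseq \<Rightarrow> finseq \<Rightarrow> finseq" is "\<lambda>u v i. u i + v i"
  subgoal for u v
    by (rule finite_subset[of _ "{i. u i \<noteq> 0} \<union> {i. v i \<noteq> 0}"]) auto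
  done

lift_definition minus_finseq :: "finseq \<Rightarrow> finseq \<Rightarrow> finseq" is "\<lambda>u v i. u i - v i"
  subgoal for u v
    by (rule finite_subset[of _ "{i. u i \<noteq> 0} \<union> {i. v i \<noteq> 0}"]) auto
  done

lift_definition uminus_finseq :: "finseq \<Rightarrow> finseq" is "\<lambda>u i. - u i" by simp

lift_definition scaleR_finseq :: "real \<Rightarrow> finseq \<Rightarrow> finseq" is "\<lambda>r u i. r * u i"
  subgoal for r u by (rule finite_subset[of _ "{i. u i \<noteq> 0}"]) auto
  done

instance
proof
  fix x y z :: finseq and r s :: real
  show "x + y + z = x + (y + z)" "x + y = y + x" "0 + x = x" "- x + x = 0" "x - y = x + - y"
    "r *\<^sub>R (x + y) = r *\<^sub>R x + r *\<^sub>R y" "(r + s) *\<^sub>R x = r *\<^sub>R x + s *\<^sub>R x"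
    "r *\<^sub>R s *\<^sub>R x = (r * s) *\<^sub>R x" "1 *\<^sub>R x = x"
    by (transfer; simp add: fun_eq_iff algebra_simps)+
qed

end

instantiation finseq :: real_inner
begin

definition inner_finseq :: "finseq \<Rightarrow> finseq \<Rightarrow> real" where
  "inner_finseq x y = (\<Sum>i | coord x i \<noteq> 0. coord x i * coord y i)"

definition norm_finseq :: "finseq \<Rightarrow> real" where
  "norm_finseq x = sqrt (inner x x)"

definition sgn_finseq :: "finseq \<Rightarrow> finseq" where
  "sgn_finseq x = x /\<^sub>R norm x"

definition dist_finseq :: "finseq \<Rightarrow> finseq \<Rightarrow> real" where
  "dist_finseq x y = norm (x - y)"

definition uniformity_finseq :: "(finseq \<times> finseq) filter" where
  "uniformity_finseq = (INF e\<in>{0<..}. principal {(x, y). dist x y < e})"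

definition open_finseq :: "finseq set \<Rightarrow> bool" where
  "open_finseq U \<longleftrightarrow> (\<forall>x\<in>U. \<forall>\<^sub>F (x', y) in uniformity. x' = x \<longrightarrow> y \<in> U)"

lemma inner_finseq_superset:
  assumes "finite A" "{i. coord x i \<noteq> 0} \<subseteq> A"
  shows "inner x y = (\<Sum>i\<in>A. coord x i * coord y i)"
  unfolding inner_finseq_def using assms by (intro sum.mono_neutral_left) auto

instance
proof
  fix x y z :: finseq and r :: real
  show "dist x y = norm (x - y)" "sgn x = x /\<^sub>R norm x" "norm x = sqrt (inner x x)"
    by (simp_all add: dist_finseq_def sgn_finseq_def norm_finseq_def)
  show "uniformity = (INF e\<in>{0<..}. principal {(x :: finseq, y). dist x y < e})"
    by (simp add: uniformity_finseq_def)
  show "open U = (\<forall>x\<in>U. \<forall>\<^sub>F (x', y) in uniformity. x' = x \<longrightarrow> y \<in> U)" for U :: "finseq set"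
    by (simp add: open_finseq_def)
  let ?A = "{i. coord x i \<noteq> 0} \<union> {i. coord y i \<noteq> 0} \<union> {i. coord z i \<noteq> 0}"
  have A: "finite ?A" by simp
  have xy: "{i. coord (x + y) i \<noteq> 0} \<subseteq> ?A"
    by (auto simp: plus_finseq.rep_eq)
  have rx: "{i. coord (r *\<^sub>R x) i \<noteq> 0} \<subseteq> ?A"
    by (auto simp: scaleR_finseq.rep_eq)
  have x: "{i. coord x i \<noteq> 0} \<subseteq> ?A" and y: "{i. coord y i \<noteq> 0} \<subseteq> ?A" by auto
  show "inner x y = inner y x"
    by (simp only: inner_finseq_superset[OF A x] inner_finseq_superset[OF A y] mult.commute)
  show "inner (x + y) z = inner x z + inner y z"
    by (simp only: inner_finseq_superset[OF A x] inner_finseq_superset[OF A y]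
        inner_finseq_superset[OF A xy] plus_finseq.rep_eq distrib_right sum.distrib)
  show "inner (r *\<^sub>R x) y = r * inner x y"
    by (simp only: inner_finseq_superset[OF A x] inner_finseq_superset[OF A rx]
        scaleR_finseq.rep_eq sum_distrib_left mult.assoc)
  show "0 \<le> inner x x"
    unfolding inner_finseq_def by (intro sum_nonneg) simp
  have "inner x x = 0 \<longleftrightarrow> (\<forall>i\<in>{i. coord x i \<noteq> 0}. coord x i * coord x i = 0)"
    unfolding inner_finseq_def by (intro sum_nonneg_eq_0_iff) simp_all
  also have "\<dots> \<longleftrightarrow> x = 0"
    by (auto intro: finseq_eqI simp: zero_finseq.rep_eq)
  finally show "inner x x = 0 \<longleftrightarrow> x = 0" .
qed

end

definition Rn :: "nat \<Rightarrow> finseq set" where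
  "Rn n = {x. \<forall>i\<ge>n. coord x i = 0}"

lemma subspace_Rn: "subspace (Rn n)"
  by (auto simp: subspace_def Rn_def zero_finseq.rep_eq plus_finseq.rep_eq scaleR_finseq.rep_eq)

lemma Rn_coords: "\<exists>!x. x \<in> Rn n \<and> (\<forall>i<n. coord x i = v i)"
proof (rule ex_ex1I)
  have "finite {i. (if i < n then v i else 0) \<noteq> 0}"
    by (rule finite_subset[of _ "{..<n}"]) (auto split: if_splits)
  then have "coord (Abs_finseq (\<lambda>i. if i < n then v i else 0)) = (\<lambda>i. if i < n then v i else 0)"
    by (intro Abs_finseq_inverse) simp
  then show "\<exists>x. x \<in> Rn n \<and> (\<forall>i<n. coord x i = v i)"
    by (intro exI[of _ "Abs_finseq (\<lambda>i. if i < n then v i else 0)"]) (simp add: Rn_def)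
next
  fix x y
  assume "x \<in> Rn n \<and> (\<forall>i<n. coord x i = v i)" "y \<in> Rn n \<and> (\<forall>i<n. coord y i = v i)"
  then show "x = y"
    by (intro finseq_eqI) (metis (mono_tags) Rn_def mem_Collect_eq not_less)
qed

lemma inner_Rn:
  assumes "x \<in> Rn n"
  shows "inner x y = (\<Sum>i<n. coord x i * coord y i)"
  using assms by (intro inner_finseq_superset) (auto simp: Rn_def not_le[symmetric])

text \<open>
  A function on \<open>Rn n\<close> is a function on the ambient space of which only the values on \<open>Rn n\<close>
  are used. The witness \<open>G\<close> is its gradient, which is unique on \<open>Rn n\<close>.
\<close>

definition admissible :: "nat \<Rightarrow> real \<Rightarrow> real \<Rightarrow> finseq \<Rightarrow> finseq \<Rightarrow> (finseq \<Rightarrow> real) set" where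
  "admissible n l L w g = {f. \<exists>G.
     (\<forall>x\<in>Rn n. G x \<in> Rn n \<and> (f has_derivative (\<lambda>h. G x \<bullet> h)) (at x within Rn n)) \<and>
     L-lipschitz_on (Rn n) G \<and>
     (\<forall>x\<in>Rn n. \<forall>y\<in>Rn n. l * (norm (x - y))\<^sup>2 / 2 \<le> f y - f x - G x \<bullet> (y - x)) \<and>
     G w = g}"

definition potential :: "nat \<Rightarrow> real \<Rightarrow> (finseq \<Rightarrow> real) \<Rightarrow> finseq \<Rightarrow> finseq \<Rightarrow> real" where
  "potential n l f x y =
     (2 / l) * (f x - (INF z\<in>Rn n. f z)) + (norm (y - arg_min_on f (Rn n)))\<^sup>2"

definition worst_ratio ::
  "nat \<Rightarrow> real \<Rightarrow> real \<Rightarrow> finseq \<Rightarrow> finseq \<Rightarrow> finseq \<Rightarrow> finseq \<Rightarrow> finseq \<Rightarrow> finseq \<Rightarrow> ereal" where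
  "worst_ratio n l L w g x0 y0 x y =
     (SUP f\<in>admissible n l L w g. ereal (potential n l f x y / potential n l f x0 y0))"

end

theory Submission
  imports Defs
begin

text \<open>
  Write \<open>s = \<surd>\<kappa>\<close>. The upper bound adds the descent inequality for the gradient step at \<open>w\<close> to the
  strong convexity inequalities from \<open>w\<close> to \<open>x0\<close> and from \<open>w\<close> to the minimizer.

  For the lower bound a single quadratic per data set suffices, whatever the points of \<open>M\<close>. In units
  with \<open>l = 1\<close> and \<open>norm g / L = 1\<close>, take orthonormal \<open>e\<close>, \<open>b\<close>, \<open>u\<close> with \<open>g = s\<^sup>2 e\<close> and
  \<open>x0 - w = t b\<close>, hence \<open>y0 - w = - s t b\<close>, and place the minimizer at \<open>w - s e - s t b + \<beta> u\<close>.
  The best point \<open>y\<close> of \<open>M\<close> still misses it by \<open>\<beta>\<close>, and its \<open>b\<close>-component is that of \<open>y0\<close>, so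
  that \<open>t\<close> does not enlarge the initial potential. The Hessian is the identity plus two orthogonal
  rank-one terms: one along \<open>d\<close>, forced by the vanishing of the gradient at the minimizer,
  and one of size about \<open>s\<close> along a direction orthogonal to the minimizer and to \<open>d\<close>, which makes it
  useless to move \<open>x\<close> along \<open>b\<close>. Both potentials are then \<open>2 s\<^sup>3 + O(s\<^sup>2)\<close> and differ by
  \<open>2 s\<^sup>2 + O(s)\<close>.

  The minimum is attained because \<open>q\<close> is a supremum of continuous functions, each of which exceeds 1
  outside a bounded set.
\<close>

section \<open>Topology and orthogonality in \<open>Rn n\<close>, and minima of suprema\<close>

lemma coord_simps [simp]:
  "coord 0 i = 0" "coord (x + y) i = coord x i + coord y i" "coord (x - y) i = coord x i - coord y i"
  "coord (c *\<^sub>R x) i = c * coord x i"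
  by (simp_all add: zero_finseq.rep_eq plus_finseq.rep_eq minus_finseq.rep_eq scaleR_finseq.rep_eq)

lemma abs_coord_le_norm: "\<bar>coord x i\<bar> \<le> norm x"
proof -
  let ?A = "insert i {i. coord x i \<noteq> 0}"
  have "(coord x i)\<^sup>2 \<le> (\<Sum>i\<in>?A. coord x i * coord x i)"
    unfolding power2_eq_square by (rule member_le_sum) auto
  also have "\<dots> = (norm x)\<^sup>2"
    unfolding power2_norm_eq_inner by (intro inner_finseq_superset[symmetric]) auto
  finally show ?thesis
    by (simp add: abs_le_square_iff[symmetric])
qed

text \<open>The ambient space is infinite-dimensional, so closed bounded sets need not be compact
  there. Inside \<open>Rn n\<close> compactness is built one coordinate at a time: with
  \<open>b\<close> the unit vector of the new coordinate, the next cube is the continuous image of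
  the previous cube times an interval.\<close>

lemma compact_cube_Rn:
  assumes "0 \<le> r"
  shows "compact {x \<in> Rn n. \<forall>i. \<bar>coord x i\<bar> \<le> r}"
proof (induction n)
  case 0
  have "{x \<in> Rn 0. \<forall>i. \<bar>coord x i\<bar> \<le> r} \<subseteq> {0}"
    by (auto simp: Rn_def intro: finseq_eqI)
  then show ?case
    using finite_imp_compact finite_subset by blast
next
  case (Suc n)
  let ?C = "\<lambda>n. {x \<in> Rn n. \<forall>i. \<bar>coord x i\<bar> \<le> r}"
  obtain b where "b \<in> Rn (Suc n)" "\<forall>i<Suc n. coord b i = (if i = n then 1 else 0)"
    using Rn_coords[of "Suc n" "\<lambda>i. if i = n then 1 else 0"] by blast
  then have b: "coord b i = (if i = n then 1 else 0)" for i
    by (cases "i < Suc n") (auto simp: Rn_def)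
  have "?C (Suc n) = (\<lambda>(x, t). x + t *\<^sub>R b) ` (?C n \<times> {-r..r})" (is "_ = ?I")
  proof (intro equalityI subsetI)
    fix x assume x: "x \<in> ?C (Suc n)"
    have "x - coord x n *\<^sub>R b \<in> ?C n"
      using x assms by (auto simp: Rn_def b le_Suc_eq Suc_le_eq)
    moreover have "coord x n \<in> {-r..r}"
      using x by (auto simp: abs_le_iff minus_le_iff)
    ultimately show "x \<in> ?I"
      by (intro image_eqI[of _ _ "(x - coord x n *\<^sub>R b, coord x n)"]) auto
  qed (auto simp: Rn_def b abs_le_iff)
  then show ?case
    using Suc by (auto intro!: compact_continuous_image compact_Times continuous_intros
        simp: case_prod_beta)
qed

lemma compact_subset_Rn:
  assumes "closed S" "bounded S" "S \<subseteq> Rn n"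
  shows "compact S"
proof -
  obtain r where r: "\<And>x. x \<in> S \<Longrightarrow> norm x \<le> r"
    using \<open>bounded S\<close> by (auto simp: bounded_iff)
  have "S = {x \<in> Rn n. \<forall>i. \<bar>coord x i\<bar> \<le> max r 0} \<inter> S"
    using assms(3) order_trans[OF abs_coord_le_norm r] by (auto simp: le_max_iff_disj)
  moreover have "compact ({x \<in> Rn n. \<forall>i. \<bar>coord x i\<bar> \<le> max r 0} \<inter> S)"
    by (intro compact_Int_closed compact_cube_Rn assms) simp
  ultimately show ?thesis by simp
qed

text \<open>Each coordinate is dominated by the norm, so a vanishing coordinate stays zero under
  limits.\<close>

lemma closed_Rn: "closed (Rn n)"
proof -
  have "x \<in> Rn n" if "\<And>k. X k \<in> Rn n" "X \<longlonglongrightarrow> x" for X x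
    unfolding Rn_def
  proof safe
    fix i assume i: "n \<le> i"
    have "(\<lambda>k. norm (X k - x)) \<longlonglongrightarrow> 0"
      using that(2) by (simp add: LIM_zero tendsto_norm_zero)
    moreover have "\<bar>coord x i\<bar> \<le> norm (X k - x)" for k
      using abs_coord_le_norm[of "X k - x" i] that(1)[of k] i by (simp add: Rn_def)
    ultimately have "\<bar>coord x i\<bar> \<le> 0"
      by (intro LIMSEQ_le_const) auto
    then show "coord x i = 0" by simp
  qed
  then show ?thesis
    by (auto simp: closed_sequential_limits)
qed

text \<open>Truncate both vectors to their first three coordinates, take a nonzero vector of
  \<open>real ^ 3\<close> orthogonal to the two truncations, and pad it with zeros; the padding
  makes the inner products agree.\<close>

lemma exists_orthogonal_unit_Rn:
  assumes "3 \<le> n" "a \<in> Rn n" "b \<in> Rn n"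
  obtains u where "u \<in> Rn n" "norm u = 1" "u \<bullet> a = 0" "u \<bullet> b = 0"
proof -
  let ?v = "\<lambda>x. vector [coord x 0, coord x 1, coord x 2] :: real ^ 3"
  have "dim {?v a, ?v b} < DIM(real ^ 3)"
    using dim_le_card'[of "{?v a, ?v b}"] card_insert_le_m1[of 2 "{?v b}" "?v a"] by simp
  then obtain c where c: "c \<noteq> 0" "\<And>y. y \<in> {?v a, ?v b} \<Longrightarrow> orthogonal c y"
    using orthogonal_to_subspace_exists[of "{?v a, ?v b}"] span_base by metis
  obtain u where u: "u \<in> Rn n"
    "\<forall>i<n. coord u i = (if i = 0 then c $ 1 else if i = 1 then c $ 2 else if i = 2 then c $ 3 else 0)"
    using Rn_coords[of n "\<lambda>i. if i = 0 then c $ 1 else if i = 1 then c $ 2 else if i = 2 then c $ 3 else 0"]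
    by blast
  have inner: "u \<bullet> x = c \<bullet> ?v x" for x
  proof -
    have "u \<bullet> x = (\<Sum>i<n. coord u i * coord x i)"
      using inner_Rn[OF u(1)] .
    also have "\<dots> = (\<Sum>i<3. coord u i * coord x i)"
      using u(2) assms(1) by (intro sum.mono_neutral_right) auto
    also have "\<dots> = c \<bullet> ?v x"
      using u(2) assms(1) by (simp add: eval_nat_numeral inner_vec_def sum_3[unfolded One_nat_def])
    finally show ?thesis .
  qed
  have "u \<noteq> 0"
  proof
    assume "u = 0"
    then have "c $ 1 = 0" "c $ 2 = 0" "c $ 3 = 0"
      using u(2) assms(1) by (auto dest: spec[of _ 0] spec[of _ 1] spec[of _ 2])
    then show False using c(1) by (simp add: vec_eq_iff forall_3)
  qed
  show ?thesis
  proof (rule that[of "u /\<^sub>R norm u"])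
    show "u /\<^sub>R norm u \<in> Rn n" using u(1) by (rule subspace_scale[OF subspace_Rn])
    show "norm (u /\<^sub>R norm u) = 1" using \<open>u \<noteq> 0\<close> by simp
  qed (use c(2) in \<open>auto simp: inner orthogonal_def\<close>)
qed

text \<open>A supremum of continuous functions is lower semicontinuous: along a convergent
  subsequence of a minimizing sequence, each \<open>h i\<close> separately passes to the limit below
  the infimum. Values in \<open>ereal\<close> allow the supremum to be infinite.\<close>

lemma SUP_continuous_attains_inf:
  fixes h :: "'b \<Rightarrow> 'a :: metric_space \<Rightarrow> real"
  assumes "compact K" "K \<noteq> {}" "\<And>i. i \<in> I \<Longrightarrow> continuous_on K (h i)"
  shows "\<exists>x\<in>K. \<forall>y\<in>K. (SUP i\<in>I. ereal (h i x)) \<le> (SUP i\<in>I. ereal (h i y))"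
proof -
  define q where "q x = (SUP i\<in>I. ereal (h i x))" for x
  obtain u where u: "\<And>j. u j \<in> q ` K" "u \<longlonglongrightarrow> Inf (q ` K)"
    using Inf_as_limit[of "q ` K"] assms(2) by auto
  then have "\<forall>j. \<exists>x. x \<in> K \<and> u j = q x" by blast
  from choice[OF this] obtain X where X: "\<And>j. X j \<in> K" "\<And>j. u j = q (X j)"
    by blast
  obtain x r where x: "x \<in> K" "strict_mono r" "(X \<circ> r) \<longlonglongrightarrow> x"
    using seq_compactE[OF compact_imp_seq_compact[OF assms(1)], of X] X(1) by blast
  have lim: "(\<lambda>j. q (X (r j))) \<longlonglongrightarrow> Inf (q ` K)"
    using LIMSEQ_subseq_LIMSEQ[OF u(2) x(2)] by (simp add: o_def X(2))
  have "ereal (h i x) \<le> Inf (q ` K)" if i: "i \<in> I" for i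
  proof (rule LIMSEQ_le[OF _ lim])
    have "(\<lambda>j. h i (X (r j))) \<longlonglongrightarrow> h i x"
      using assms(3)[OF i] x X(1) by (simp add: continuous_on_sequentially o_def)
    then show "(\<lambda>j. ereal (h i (X (r j)))) \<longlonglongrightarrow> ereal (h i x)"
      by simp
    show "\<exists>N. \<forall>j\<ge>N. ereal (h i (X (r j))) \<le> q (X (r j))"
      using i by (auto simp: q_def intro: SUP_upper)
  qed
  then have "q x \<le> Inf (q ` K)"
    unfolding q_def[of x] by (rule SUP_least)
  then show ?thesis
    using x(1) le_Inf_iff unfolding q_def by (metis image_eqI)
qed

section \<open>Strongly convex functions with Lipschitz gradient on \<open>Rn n\<close>\<close>

text \<open>The conditions of \<open>admissible\<close> with the gradient fixed as a parameter,
  apart from its value at \<open>w\<close>.\<close>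

locale strongly_convex_smooth =
  fixes n :: nat and l L :: real and f :: "finseq \<Rightarrow> real" and G :: "finseq \<Rightarrow> finseq"
  assumes l_pos: "0 < l" and L_pos: "0 < L"
    and G_mem: "x \<in> Rn n \<Longrightarrow> G x \<in> Rn n"
    and deriv: "x \<in> Rn n \<Longrightarrow> (f has_derivative (\<lambda>h. G x \<bullet> h)) (at x within Rn n)"
    and lipschitz: "L-lipschitz_on (Rn n) G"
    and strong: "x \<in> Rn n \<Longrightarrow> y \<in> Rn n \<Longrightarrow> l * (norm (x - y))\<^sup>2 / 2 \<le> f y - f x - G x \<bullet> (y - x)"
begin

lemma continuous_on_f: "continuous_on (Rn n) f"
  unfolding continuous_on_eq_continuous_within using has_derivative_continuous[OF deriv] by blast

lemma descent:
  assumes x: "x \<in> Rn n" and y: "y \<in> Rn n"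
  shows "f y \<le> f x + G x \<bullet> (y - x) + L / 2 * (norm (y - x))\<^sup>2"
proof -
  define v where "v = y - x"
  have mem: "x + t *\<^sub>R v \<in> Rn n" for t
    using x y unfolding v_def by (intro subspace_add subspace_scale subspace_diff subspace_Rn)
  \<comment> \<open>Along the segment, \<open>f\<close> minus its quadratic majorant, up to a
    constant. The Lipschitz bound and Cauchy-Schwarz make the derivative nonpositive on
    \<open>[0, 1]\<close>.\<close>
  define \<psi> where "\<psi> t = f (x + t *\<^sub>R v) - t * (G x \<bullet> v) - L / 2 * t\<^sup>2 * (norm v)\<^sup>2" for t
  have f': "((\<lambda>t. f (x + t *\<^sub>R v)) has_derivative (\<lambda>h. G (x + t *\<^sub>R v) \<bullet> (h *\<^sub>R v))) (at t)" for t
    using mem by (intro has_derivative_in_compose2[OF deriv, where f = "\<lambda>t. x + t *\<^sub>R v"])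
      (auto intro!: derivative_eq_intros)
  have \<psi>': "(\<psi> has_real_derivative (G (x + t *\<^sub>R v) \<bullet> v - G x \<bullet> v - L * t * (norm v)\<^sup>2)) (at t)" for t
    unfolding \<psi>_def has_field_derivative_def
    by (rule derivative_eq_intros f' refl)+ (auto simp: fun_eq_iff algebra_simps)
  have "\<psi> 1 \<le> \<psi> 0"
  proof (rule DERIV_nonpos_imp_nonincreasing[of 0 1 \<psi>])
    fix t :: real assume t: "0 \<le> t" "t \<le> 1"
    have "(G (x + t *\<^sub>R v) - G x) \<bullet> v \<le> norm (G (x + t *\<^sub>R v) - G x) * norm v"
      by (rule norm_cauchy_schwarz)
    also have "\<dots> \<le> (L * (t * norm v)) * norm v"
      using lipschitz_onD[OF lipschitz mem[of t] x] t by (intro mult_right_mono) (auto simp: dist_norm)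
    finally show "\<exists>D. (\<psi> has_real_derivative D) (at t) \<and> D \<le> 0"
      using \<psi>'[of t] by (auto simp: inner_diff_left power2_eq_square algebra_simps)
  qed simp
  then show ?thesis
    by (simp add: \<psi>_def v_def)
qed

text \<open>The point \<open>x - (1 / L) *\<^sub>R G x\<close> minimizes the quadratic majorant
  given by \<open>descent\<close>.\<close>

lemma gradient_step:
  assumes "x \<in> Rn n"
  shows "f (x - (1 / L) *\<^sub>R G x) \<le> f x - (norm (G x))\<^sup>2 / (2 * L)"
proof -
  have "x - (1 / L) *\<^sub>R G x \<in> Rn n"
    using assms by (intro subspace_diff subspace_scale subspace_Rn G_mem)
  from descent[OF assms this]
  have "f (x - (1 / L) *\<^sub>R G x) \<le> f x - 1 / L * (norm (G x))\<^sup>2 + L / 2 * ((1 / L)\<^sup>2 * (norm (G x))\<^sup>2)"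
    using L_pos by (simp add: power2_norm_eq_inner power_divide)
  also have "\<dots> = f x - (norm (G x))\<^sup>2 / (2 * L)"
    using L_pos by (simp add: field_simps power2_eq_square)
  finally show ?thesis .
qed

lemma ex_minimizer: "\<exists>z\<in>Rn n. \<forall>y\<in>Rn n. f z \<le> f y"
proof -
  have 0: "0 \<in> Rn n" by (rule subspace_0[OF subspace_Rn])
  \<comment> \<open>Strong convexity at 0 gives
    \<open>f y - f 0 \<ge> l / 2 * norm y * (norm y - R)\<close>, so no point outside the ball of
    radius \<open>R\<close> beats the origin, and the minimum over the compact ball is
    global.\<close>
  define R where "R = 2 * norm (G 0) / l"
  have "compact (Rn n \<inter> cball 0 R)"
    by (rule compact_subset_Rn[of _ n]) (auto intro: closed_Int closed_Rn bounded_subset[OF bounded_cball])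
  moreover have R: "0 \<le> R" using l_pos by (simp add: R_def)
  ultimately obtain z where z: "z \<in> Rn n \<inter> cball 0 R" "\<forall>y\<in>Rn n \<inter> cball 0 R. f z \<le> f y"
    using continuous_attains_inf[of "Rn n \<inter> cball 0 R" f] continuous_on_subset[OF continuous_on_f] 0
    by (metis Int_lower1 Int_iff centre_in_cball empty_iff)
  have "f z \<le> f y" if y: "y \<in> Rn n" for y
  proof (cases "norm y \<le> R")
    case False
    have "0 \<le> l / 2 * norm y * (norm y - R)"
      using False l_pos by simp
    also have "\<dots> = l * (norm y)\<^sup>2 / 2 - norm (G 0) * norm y"
      using l_pos by (simp add: R_def power2_eq_square field_simps)
    also have "\<dots> \<le> l * (norm y)\<^sup>2 / 2 + G 0 \<bullet> y"
      using Cauchy_Schwarz_ineq2[of "G 0" y] by linarith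
    also have "\<dots> \<le> f y - f 0"
      using strong[OF 0 y] by simp
    finally have "f 0 \<le> f y" by simp
    moreover have "f z \<le> f 0" using bspec[OF z(2), of 0] 0 R by simp
    ultimately show ?thesis by simp
  next
    case True
    then show ?thesis using bspec[OF z(2), of y] y by simp
  qed
  then show ?thesis using z by blast
qed


end

lemma norm_lincomb3:
  fixes x y z :: "'a :: real_inner"
  shows "(norm (a *\<^sub>R x + b *\<^sub>R y + c *\<^sub>R z))\<^sup>2 =
    a\<^sup>2 * (norm x)\<^sup>2 + b\<^sup>2 * (norm y)\<^sup>2 + c\<^sup>2 * (norm z)\<^sup>2
    + 2 * a * b * (x \<bullet> y) + 2 * a * c * (x \<bullet> z) + 2 * b * c * (y \<bullet> z)"
  unfolding power2_norm_eq_inner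
  by (simp add: power2_eq_square inner_add_left inner_add_right inner_commute[of y x] inner_commute[of z x]
      inner_commute[of z y] distrib_left)

context strongly_convex_smooth begin
lemma minimizer:
  shows minimizer_mem: "arg_min_on f (Rn n) \<in> Rn n"
    and minimizer_le: "y \<in> Rn n \<Longrightarrow> f (arg_min_on f (Rn n)) \<le> f y"
proof -
  have "\<exists>x. is_arg_min f (\<lambda>x. x \<in> Rn n) x"
    using ex_minimizer unfolding is_arg_min_linorder by blast
  from someI_ex[OF this] have *: "is_arg_min f (\<lambda>x. x \<in> Rn n) (arg_min_on f (Rn n))"
    unfolding arg_min_on_def arg_min_def .
  show "arg_min_on f (Rn n) \<in> Rn n"
    using * by (simp add: is_arg_min_linorder)
  show "f (arg_min_on f (Rn n)) \<le> f y" if "y \<in> Rn n"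
    using * that by (simp add: is_arg_min_linorder)
qed

text \<open>A gradient step from the minimizer would otherwise strictly decrease
  \<open>f\<close>.\<close>

lemma G_minimizer: "G (arg_min_on f (Rn n)) = 0"
proof -
  let ?z = "arg_min_on f (Rn n)"
  have "f ?z \<le> f (?z - (1 / L) *\<^sub>R G ?z)"
    by (intro minimizer subspace_diff subspace_scale subspace_Rn G_mem)
  also note gradient_step[OF minimizer_mem]
  finally show ?thesis
    using L_pos by (simp add: divide_le_0_iff)
qed

text \<open>Strong convexity at a point with zero gradient forces every minimizer to coincide with
  it; this identifies the value of the choice operator behind \<open>arg_min_on\<close>.\<close>

lemma minimizer_eqI:
  assumes "z \<in> Rn n" "G z = 0"
  shows "arg_min_on f (Rn n) = z"
proof -
  have "l * (norm (z - arg_min_on f (Rn n)))\<^sup>2 / 2 \<le> 0"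
    using strong[OF assms(1) minimizer_mem] minimizer_le[OF assms(1)] assms(2) by simp
  then show ?thesis
    using l_pos by (auto simp: mult_le_0_iff divide_le_0_iff)
qed

lemma potential_eq:
  "potential n l f x y =
     2 / l * (f x - f (arg_min_on f (Rn n))) + (norm (y - arg_min_on f (Rn n)))\<^sup>2"
proof -
  have "(INF z\<in>Rn n. f z) = f (arg_min_on f (Rn n))"
    using minimizer by (intro cInf_eq_minimum) auto
  then show ?thesis by (simp add: potential_def)
qed

text \<open>Strong convexity at the minimizer, where the gradient vanishes. It yields both
  positivity of the potential and boundedness of its sublevel sets.\<close>

lemma potential_ge:
  assumes "x \<in> Rn n"
  shows "(norm (x - arg_min_on f (Rn n)))\<^sup>2 + (norm (y - arg_min_on f (Rn n)))\<^sup>2 \<le> potential n l f x y"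
  using strong[OF minimizer_mem assms] l_pos
  by (simp add: potential_eq G_minimizer norm_minus_commute field_simps)

section \<open>Upper bound: contraction of the potential for each function\<close>

lemma accelerated_step:
  assumes x0: "x0 \<in> Rn n" and w: "w \<in> Rn n"
    and \<kappa>: "L = l * s\<^sup>2" "1 \<le> s"
    and y0: "y0 = w - s *\<^sub>R (x0 - w)"
    and orth: "(x0 - w) \<bullet> G w = 0"
    and x1: "x1 = w - (1 / L) *\<^sub>R G w"
    and y1: "y1 = x1 + (s - 1) *\<^sub>R (x1 - x0)"
  shows "potential n l f x1 y1 \<le> (1 - 1 / s) * potential n l f x0 y0"
proof -
  define z where "z = arg_min_on f (Rn n)"
  define p where "p = x0 - w"
  define v where "v = z - w"
  define g where "g = G w"
  have s: "0 < s" using \<kappa> by simp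
  have pg: "g \<bullet> p = 0" "p \<bullet> g = 0" using orth by (simp_all add: p_def g_def inner_commute)
  have fx1: "f x1 \<le> f w - (norm g)\<^sup>2 / (2 * L)"
    using gradient_step[OF w] by (simp add: x1 g_def)
  have fz: "f w + g \<bullet> v + l / 2 * (norm v)\<^sup>2 \<le> f z"
    using strong[OF w minimizer_mem] by (simp add: z_def v_def g_def norm_minus_commute)
  have fx0: "f w + l / 2 * (norm p)\<^sup>2 \<le> f x0"
    using strong[OF w x0] pg by (simp add: p_def g_def norm_minus_commute)
  \<comment> \<open>Everything is expressed through \<open>g\<close>, \<open>p\<close> and
    \<open>v\<close>. Since \<open>g\<close> is orthogonal to \<open>p\<close>, the only cross terms
    left in the squared norms are those with \<open>v\<close>.\<close>
  have y1_z: "y1 - z = (- (s / L)) *\<^sub>R g + (1 - s) *\<^sub>R p + (- 1) *\<^sub>R v"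
    by (simp add: y1 x1 p_def v_def g_def algebra_simps flip: scaleR_add_left)
      (simp add: diff_divide_distrib)
  have ny1: "(norm (y1 - z))\<^sup>2 = (s / L)\<^sup>2 * (norm g)\<^sup>2 + (s - 1)\<^sup>2 * (norm p)\<^sup>2 + (norm v)\<^sup>2
      + 2 * (s / L) * (g \<bullet> v) + 2 * (s - 1) * (p \<bullet> v)"
    unfolding y1_z norm_lincomb3 by (simp add: pg power2_commute[of 1 s] left_diff_distrib)
  have y0_z: "y0 - z = (- s) *\<^sub>R p + 0 *\<^sub>R p + (- 1) *\<^sub>R v"
    by (simp add: y0 p_def v_def)
  have ny0: "(norm (y0 - z))\<^sup>2 = s\<^sup>2 * (norm p)\<^sup>2 + (norm v)\<^sup>2 + 2 * s * (p \<bullet> v)"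
    unfolding y0_z norm_lincomb3 by simp
  \<comment> \<open>The three inequalities enter with weights 1, \<open>1 / s\<close> and
    \<open>1 - 1 / s\<close>. The last two weights add up to 1, so \<open>f w\<close>
    cancels.\<close>
  have "f x1 - f z - (1 - 1 / s) * (f x0 - f z) = f x1 - f z / s - (1 - 1 / s) * f x0"
    by (simp add: algebra_simps)
  also have "\<dots> \<le> (f w - (norm g)\<^sup>2 / (2 * L)) - (f w + g \<bullet> v + l / 2 * (norm v)\<^sup>2) / s
      - (1 - 1 / s) * (f w + l / 2 * (norm p)\<^sup>2)"
    using s \<kappa> by (intro diff_mono mult_left_mono divide_right_mono fx1 fz fx0) auto
  also have "\<dots> = - (norm g)\<^sup>2 / (2 * L) - (g \<bullet> v + l / 2 * (norm v)\<^sup>2) / s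
      - (1 - 1 / s) * (l / 2 * (norm p)\<^sup>2)"
    by (simp add: algebra_simps add_divide_distrib)
  finally have "2 / l * (f x1 - f z - (1 - 1 / s) * (f x0 - f z))
      \<le> 2 / l * (- (norm g)\<^sup>2 / (2 * L) - (g \<bullet> v + l / 2 * (norm v)\<^sup>2) / s
      - (1 - 1 / s) * (l / 2 * (norm p)\<^sup>2))"
    using l_pos by (intro mult_left_mono) auto
  \<comment> \<open>The form of \<open>y1\<close> makes the \<open>p \<bullet> v\<close> terms of
    the two distances cancel and reproduces the \<open>g \<bullet> v\<close> term of the left side.
    What remains is a multiple of \<open>(norm p)\<^sup>2\<close> with favourable sign.\<close>
  also have "\<dots> = (1 - 1 / s) * (norm (y0 - z))\<^sup>2 - (norm (y1 - z))\<^sup>2 - (s - 1 / s) * (norm p)\<^sup>2"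
  proof -
    have *: "(s / L)\<^sup>2 = 1 / (l * L)" "s / L = 1 / (l * s)"
      using l_pos s by (simp_all add: \<kappa> power2_eq_square field_simps)
    show ?thesis
      unfolding ny0 ny1 * using l_pos s L_pos
      by (simp add: field_simps power2_eq_square) (simp add: \<kappa> power2_eq_square)
  qed
  also have "\<dots> \<le> (1 - 1 / s) * (norm (y0 - z))\<^sup>2 - (norm (y1 - z))\<^sup>2"
  proof -
    have "1 / s \<le> 1" using \<kappa>(2) by simp
    then have "0 \<le> s - 1 / s" using \<kappa>(2) by linarith
    then have "0 \<le> (s - 1 / s) * (norm p)\<^sup>2" by simp
    then show ?thesis by simp
  qed
  finally have "2 / l * (f x1 - f z) - (1 - 1 / s) * (2 / l * (f x0 - f z))
      \<le> (1 - 1 / s) * (norm (y0 - z))\<^sup>2 - (norm (y1 - z))\<^sup>2"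
    by (simp only: right_diff_distrib[of "2 / l" "f x1 - f z"] mult.left_commute[of "2 / l" "1 - 1 / s"])
  then show ?thesis
    unfolding potential_eq z_def[symmetric] distrib_left by linarith
qed

end

section \<open>Membership in the function class, and its quadratic members\<close>

lemma (in strongly_convex_smooth) f_admissible:
  assumes "G w = g"
  shows "f \<in> admissible n l L w g"
  using assms G_mem deriv lipschitz strong unfolding admissible_def by blast

lemma admissibleE:
  assumes "f \<in> admissible n l L w g" "0 < l" "0 < L"
  obtains G where "strongly_convex_smooth n l L f G" "G w = g"
proof -
  obtain G where G: "\<And>x. x \<in> Rn n \<Longrightarrow> G x \<in> Rn n"
    "\<And>x. x \<in> Rn n \<Longrightarrow> (f has_derivative (\<lambda>h. G x \<bullet> h)) (at x within Rn n)"
    "L-lipschitz_on (Rn n) G"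
    "\<And>x y. x \<in> Rn n \<Longrightarrow> y \<in> Rn n \<Longrightarrow> l * (norm (x - y))\<^sup>2 / 2 \<le> f y - f x - G x \<bullet> (y - x)"
    "G w = g"
    using assms(1) unfolding admissible_def by blast
  show ?thesis
    by (rule that[OF strongly_convex_smooth.intro[OF assms(2,3) G(1-4)] G(5)])
qed

text \<open>The quadratic with value 0 and gradient \<open>g\<close> at \<open>w\<close> whose
  Hessian is \<open>l\<close> times the identity plus the rank-one terms
  \<open>c\<^sub>1 d d^T\<close> and \<open>c\<^sub>2 r r^T\<close>.\<close>

definition quadratic ::
  "real \<Rightarrow> finseq \<Rightarrow> finseq \<Rightarrow> real \<Rightarrow> finseq \<Rightarrow> real \<Rightarrow> finseq \<Rightarrow> finseq \<Rightarrow> real" where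
  "quadratic l w g c\<^sub>1 d c\<^sub>2 r z = g \<bullet> (z - w) + l / 2 * ((z - w) \<bullet> (z - w))
     + c\<^sub>1 / 2 * (d \<bullet> (z - w))\<^sup>2 + c\<^sub>2 / 2 * (r \<bullet> (z - w))\<^sup>2"

definition quadratic_grad ::
  "real \<Rightarrow> finseq \<Rightarrow> finseq \<Rightarrow> real \<Rightarrow> finseq \<Rightarrow> real \<Rightarrow> finseq \<Rightarrow> finseq \<Rightarrow> finseq" where
  "quadratic_grad l w g c\<^sub>1 d c\<^sub>2 r z = g + l *\<^sub>R (z - w)
     + (c\<^sub>1 * (d \<bullet> (z - w))) *\<^sub>R d + (c\<^sub>2 * (r \<bullet> (z - w))) *\<^sub>R r"

text \<open>For orthogonal \<open>d\<close> and \<open>r\<close> the Hessian has eigenvalues among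
  \<open>l\<close>, \<open>l + c\<^sub>1 * (norm d)\<^sup>2\<close> and
  \<open>l + c\<^sub>2 * (norm r)\<^sup>2\<close>, all in the interval from \<open>l\<close> to
  \<open>L\<close>.\<close>

lemma strongly_convex_smooth_quadratic:
  assumes "0 < l" "l \<le> L" "w \<in> Rn n" "g \<in> Rn n" "d \<in> Rn n" "r \<in> Rn n"
    and orth: "d \<bullet> r = 0" and c: "0 \<le> c\<^sub>1" "0 \<le> c\<^sub>2"
    and d: "c\<^sub>1 * (norm d)\<^sup>2 \<le> L - l" and r: "c\<^sub>2 * (norm r)\<^sup>2 \<le> L - l"
  shows "strongly_convex_smooth n l L (quadratic l w g c\<^sub>1 d c\<^sub>2 r) (quadratic_grad l w g c\<^sub>1 d c\<^sub>2 r)"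
proof
  fix x assume x: "x \<in> Rn n"
  show "quadratic_grad l w g c\<^sub>1 d c\<^sub>2 r x \<in> Rn n"
    unfolding quadratic_grad_def
    by (intro subspace_add subspace_diff subspace_scale subspace_Rn assms x)
  show "(quadratic l w g c\<^sub>1 d c\<^sub>2 r has_derivative (\<lambda>h. quadratic_grad l w g c\<^sub>1 d c\<^sub>2 r x \<bullet> h))
    (at x within Rn n)"
    unfolding quadratic_def[abs_def] quadratic_grad_def
    by (rule derivative_eq_intros refl)+
      (auto simp: fun_eq_iff inner_add_left inner_commute algebra_simps)
next
  show "L-lipschitz_on (Rn n) (quadratic_grad l w g c\<^sub>1 d c\<^sub>2 r)"
  proof (rule lipschitz_onI)
    fix x y :: finseq
    define v where "v = x - y"
    \<comment> \<open>With \<open>u\<close> the rank-one part of the Hessian applied to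
      \<open>v\<close>, orthogonality gives \<open>(norm u)\<^sup>2 \<le> (L - l) * P\<close> where
      \<open>P = u \<bullet> v\<close>; Cauchy-Schwarz then gives
      \<open>P \<le> (L - l) * (norm v)\<^sup>2\<close>. The two bounds replace a spectral
      argument.\<close>
    define P where "P = c\<^sub>1 * (d \<bullet> v)\<^sup>2 + c\<^sub>2 * (r \<bullet> v)\<^sup>2"
    have P: "0 \<le> P" using c by (simp add: P_def)
    define u where "u = (c\<^sub>1 * (d \<bullet> v)) *\<^sub>R d + (c\<^sub>2 * (r \<bullet> v)) *\<^sub>R r"
    have uv: "u \<bullet> v = P"
      by (simp add: u_def P_def inner_add_left power2_eq_square)
    have "(norm u)\<^sup>2 = (c\<^sub>1 * (d \<bullet> v))\<^sup>2 * (norm d)\<^sup>2 + (c\<^sub>2 * (r \<bullet> v))\<^sup>2 * (norm r)\<^sup>2"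
      using norm_lincomb3[of "c\<^sub>1 * (d \<bullet> v)" d "c\<^sub>2 * (r \<bullet> v)" r 0 r] orth by (simp add: u_def)
    also have "\<dots> = c\<^sub>1 * (d \<bullet> v)\<^sup>2 * (c\<^sub>1 * (norm d)\<^sup>2) + c\<^sub>2 * (r \<bullet> v)\<^sup>2 * (c\<^sub>2 * (norm r)\<^sup>2)"
      by (simp add: power2_eq_square)
    also have "\<dots> \<le> c\<^sub>1 * (d \<bullet> v)\<^sup>2 * (L - l) + c\<^sub>2 * (r \<bullet> v)\<^sup>2 * (L - l)"
      using c d r by (intro add_mono mult_left_mono) auto
    finally have u: "(norm u)\<^sup>2 \<le> (L - l) * P"
      by (simp add: P_def algebra_simps)
    have "P * P \<le> (norm u)\<^sup>2 * (norm v)\<^sup>2"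
      using Cauchy_Schwarz_ineq[of u v] unfolding power2_norm_eq_inner uv power2_eq_square[of P] .
    also have "\<dots> \<le> ((L - l) * P) * (norm v)\<^sup>2"
      by (intro mult_right_mono u) simp
    finally have "P * P \<le> P * ((L - l) * (norm v)\<^sup>2)"
      by (simp add: ac_simps)
    then have Pv: "P \<le> (L - l) * (norm v)\<^sup>2"
      using P assms(2) by (cases "P = 0") auto
    have "quadratic_grad l w g c\<^sub>1 d c\<^sub>2 r x - quadratic_grad l w g c\<^sub>1 d c\<^sub>2 r y = l *\<^sub>R v + 1 *\<^sub>R u + 0 *\<^sub>R u"
      by (simp add: quadratic_grad_def v_def u_def inner_diff_right algebra_simps)
    then have "(norm (quadratic_grad l w g c\<^sub>1 d c\<^sub>2 r x - quadratic_grad l w g c\<^sub>1 d c\<^sub>2 r y))\<^sup>2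
        = l\<^sup>2 * (norm v)\<^sup>2 + (norm u)\<^sup>2 + 2 * l * P"
      by (simp only: norm_lincomb3) (simp add: uv inner_commute[of v u])
    also have "\<dots> \<le> l\<^sup>2 * (norm v)\<^sup>2 + (L + l) * P"
      using u by (simp add: algebra_simps)
    also have "\<dots> \<le> l\<^sup>2 * (norm v)\<^sup>2 + (L + l) * ((L - l) * (norm v)\<^sup>2)"
      using assms(1,2) by (intro add_left_mono mult_left_mono Pv) simp
    also have "\<dots> = (L * norm v)\<^sup>2"
      by (simp add: power2_eq_square algebra_simps)
    finally show "dist (quadratic_grad l w g c\<^sub>1 d c\<^sub>2 r x) (quadratic_grad l w g c\<^sub>1 d c\<^sub>2 r y)
        \<le> L * dist x y"
      unfolding dist_norm v_def[symmetric] by (rule power2_le_imp_le) (use assms(1,2) in simp)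
  qed (use assms in simp)
next
  fix x y :: finseq
  define v where "v = x - w"
  define h where "h = y - x"
  have "quadratic l w g c\<^sub>1 d c\<^sub>2 r y - quadratic l w g c\<^sub>1 d c\<^sub>2 r x - quadratic_grad l w g c\<^sub>1 d c\<^sub>2 r x \<bullet> (y - x)
      = l / 2 * (h \<bullet> h) + c\<^sub>1 / 2 * (d \<bullet> h)\<^sup>2 + c\<^sub>2 / 2 * (r \<bullet> h)\<^sup>2"
  proof -
    have y: "y - w = v + h" by (simp add: v_def h_def)
    show ?thesis
      unfolding quadratic_def quadratic_grad_def y v_def[symmetric] h_def[symmetric]
      by (simp add: inner_add_left inner_add_right inner_commute[of h v] power2_eq_square field_simps)
  qed
  moreover have "(norm (x - y))\<^sup>2 = h \<bullet> h"
    by (simp add: h_def norm_minus_commute[of x] power2_norm_eq_inner)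
  ultimately show "l * (norm (x - y))\<^sup>2 / 2 \<le> quadratic l w g c\<^sub>1 d c\<^sub>2 r y - quadratic l w g c\<^sub>1 d c\<^sub>2 r x
      - quadratic_grad l w g c\<^sub>1 d c\<^sub>2 r x \<bullet> (y - x)"
    using c by simp
qed (use assms in auto)

lemma quadratic_grad_centre: "quadratic_grad l w g c\<^sub>1 d c\<^sub>2 r w = g"
  by (simp add: quadratic_grad_def)

text \<open>The quadratic whose Hessian is \<open>l\<close> times the identity is a member.\<close>

lemma admissible_nonempty:
  assumes "0 < l" "l \<le> L" "w \<in> Rn n" "g \<in> Rn n"
  shows "admissible n l L w g \<noteq> {}"
  using strongly_convex_smooth.f_admissible[OF strongly_convex_smooth_quadratic quadratic_grad_centre,
      of l L w n g 0 0 0 0] assms subspace_0[OF subspace_Rn] by auto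

section \<open>Positive denominators and attainment of the minimum\<close>

text \<open>The potential could vanish only if \<open>x0\<close> and \<open>y0\<close> were both the
  minimizer. Then \<open>w\<close> would be the minimizer too, but the gradient there is
  \<open>g\<close>, which is nonzero.\<close>

lemma potential_pos:
  assumes "f \<in> admissible n l L w g" "0 < l" "0 < L" "g \<noteq> 0"
    and "x0 \<in> Rn n" "y0 = w - s *\<^sub>R (x0 - w)" "0 < s"
  shows "0 < potential n l f x0 y0"
proof -
  obtain G where G: "strongly_convex_smooth n l L f G" "G w = g"
    using admissibleE[OF assms(1-3)] .
  interpret strongly_convex_smooth n l L f G by fact
  let ?z = "arg_min_on f (Rn n)"
  have "\<not> (x0 = ?z \<and> y0 = ?z)"
  proof
    assume *: "x0 = ?z \<and> y0 = ?z"
    then have "(1 + s) *\<^sub>R (?z - w) = 0"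
      using assms(6) by (simp add: algebra_simps)
    then have "w = ?z" using \<open>0 < s\<close> by auto
    then show False using G_minimizer G(2) \<open>g \<noteq> 0\<close> by metis
  qed
  then have "0 < (norm (x0 - ?z))\<^sup>2 + (norm (y0 - ?z))\<^sup>2"
    by (auto simp: sum_power2_gt_zero_iff)
  then show ?thesis using potential_ge[OF assms(5)] by (rule less_le_trans)
qed

lemma worst_ratio_attains_min:
  assumes l: "0 < l" "l \<le> L" and w: "w \<in> Rn n" and g: "g \<in> Rn n"
    and pos: "\<And>f. f \<in> admissible n l L w g \<Longrightarrow> 0 < potential n l f x0 y0"
    and M: "closed M" "M \<subseteq> Rn n" and x1: "x1 \<in> M" "y1 \<in> M"
    and le: "worst_ratio n l L w g x0 y0 x1 y1 \<le> 1"
  shows "\<exists>xm\<in>M. \<exists>ym\<in>M. \<forall>x\<in>M. \<forall>y\<in>M. worst_ratio n l L w g x0 y0 xm ym \<le> worst_ratio n l L w g x0 y0 x y"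
proof -
  let ?F = "admissible n l L w g"
  let ?q = "worst_ratio n l L w g x0 y0"
  have L: "0 < L" using l by simp
  \<comment> \<open>One admissible function is enough to confine all pairs with ratio at most 1: its
    potential at such a pair is at most its initial potential, which bounds both distances to
    \<open>z\<close> by \<open>R\<close>.\<close>
  obtain f where f: "f \<in> ?F"
    using admissible_nonempty[OF l w g] by auto
  obtain G where "strongly_convex_smooth n l L f G"
    using admissibleE[OF f l(1) L] .
  then interpret strongly_convex_smooth n l L f G .
  define z where "z = arg_min_on f (Rn n)"
  define R where "R = sqrt (potential n l f x0 y0)"
  have near: "norm (x - z) \<le> R \<and> norm (y - z) \<le> R"
    if "x \<in> M" "?q x y \<le> 1" for x y
  proof -
    have "ereal (potential n l f x y / potential n l f x0 y0) \<le> 1"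
      using that(2) f unfolding worst_ratio_def by (auto simp: SUP_le_iff)
    then have "potential n l f x y \<le> potential n l f x0 y0"
      using pos[OF f] by (simp add: one_ereal_def)
    then have "(norm (x - z))\<^sup>2 + (norm (y - z))\<^sup>2 \<le> potential n l f x0 y0"
      using potential_ge[of x y] that(1) M(2) unfolding z_def by force
    moreover have "0 \<le> (norm (x - z))\<^sup>2" "0 \<le> (norm (y - z))\<^sup>2" by simp_all
    ultimately show ?thesis
      unfolding R_def by (intro conjI real_le_rsqrt) linarith+
  qed
  define K where "K = M \<inter> cball z R"
  have K: "compact K"
    unfolding K_def using M
    by (intro compact_subset_Rn[of _ n] closed_Int bounded_subset[OF bounded_cball[of z R]]) auto
  have in_K: "(x, y) \<in> K \<times> K" if "x \<in> M" "y \<in> M" "?q x y \<le> 1" for x y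
    using that near[of x y] by (simp add: K_def dist_norm norm_minus_commute)
  have "continuous_on (K \<times> K) (\<lambda>(x, y). potential n l h x y / potential n l h x0 y0)"
    if h: "h \<in> ?F" for h
  proof -
    obtain H where "strongly_convex_smooth n l L h H"
      using admissibleE[OF h l(1) L] .
    then interpret h: strongly_convex_smooth n l L h H .
    have "continuous_on (K \<times> K) (\<lambda>p. h (fst p))"
      using M(2) by (intro continuous_on_compose2[OF h.continuous_on_f] continuous_intros) (auto simp: K_def)
    moreover define D where "D = potential n l h x0 y0"
    moreover have "D \<noteq> 0" using pos[OF h] by (simp add: D_def)
    ultimately have "continuous_on (K \<times> K) (\<lambda>p. (2 / l * (h (fst p) - h (arg_min_on h (Rn n)))
        + (norm (snd p - arg_min_on h (Rn n)))\<^sup>2) / D)"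
      by (intro continuous_on_divide continuous_on_add continuous_on_mult continuous_on_diff
          continuous_on_power continuous_on_norm continuous_on_const continuous_on_snd continuous_on_id) auto
    then show ?thesis
      unfolding D_def case_prod_beta h.potential_eq .
  qed
  moreover have "K \<times> K \<noteq> {}"
    using in_K[OF x1 le] by blast
  ultimately have "\<exists>p\<in>K \<times> K. \<forall>p'\<in>K \<times> K.
      (SUP h\<in>?F. ereal (case p of (x, y) \<Rightarrow> potential n l h x y / potential n l h x0 y0))
      \<le> (SUP h\<in>?F. ereal (case p' of (x, y) \<Rightarrow> potential n l h x y / potential n l h x0 y0))"
    by (intro SUP_continuous_attains_inf compact_Times K)
  then obtain p where p: "p \<in> K \<times> K" "\<forall>p'\<in>K \<times> K. ?q (fst p) (snd p) \<le> ?q (fst p') (snd p')"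
    by (auto simp only: worst_ratio_def case_prod_beta)
  \<comment> \<open>The minimum over \<open>K \<times> K\<close> is global: it is at most the value
    at \<open>(x1, y1)\<close>, hence at most 1, whereas pairs of \<open>M\<close> outside
    \<open>K \<times> K\<close> have value above 1.\<close>
  have "?q (fst p) (snd p) \<le> ?q x y" if "x \<in> M" "y \<in> M" for x y
  proof (cases "?q x y \<le> 1")
    case True
    then show ?thesis using bspec[OF p(2) in_K[OF that]] by simp
  next
    case False
    have "?q (fst p) (snd p) \<le> 1"
      using order_trans[OF _ le] bspec[OF p(2) in_K[OF x1 le]] by simp
    then show ?thesis using False by (meson linear order_trans)
  qed
  moreover have "fst p \<in> M" "snd p \<in> M"
    using p(1) by (auto simp: K_def)
  ultimately show ?thesis by blast
qed

lemma in_span_pair_iff: "x \<in> span {a, b} \<longleftrightarrow> (\<exists>\<alpha> \<beta>. x = \<alpha> *\<^sub>R a + \<beta> *\<^sub>R b)"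
  by (auto simp: span_insert span_singleton algebra_simps)

text \<open>The span is the fixed-point set of the orthogonal projection, which is continuous. For a
  zero generator the corresponding term of the projection vanishes.\<close>

lemma closed_span_orthogonal_pair:
  fixes a b :: "'a :: real_inner"
  assumes "a \<bullet> b = 0"
  shows "closed (span {a, b})"
proof -
  have *: "x \<in> span {a, b} \<longleftrightarrow> x = (x \<bullet> a / (a \<bullet> a)) *\<^sub>R a + (x \<bullet> b / (b \<bullet> b)) *\<^sub>R b" for x
  proof
    assume "x \<in> span {a, b}"
    then obtain \<alpha> \<beta> where "x = \<alpha> *\<^sub>R a + \<beta> *\<^sub>R b"
      by (auto simp: in_span_pair_iff)
    then show "x = (x \<bullet> a / (a \<bullet> a)) *\<^sub>R a + (x \<bullet> b / (b \<bullet> b)) *\<^sub>R b"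
      using assms by (cases "a = 0"; cases "b = 0") (simp_all add: inner_add_left inner_commute[of b a])
  qed (auto simp: in_span_pair_iff)
  have "span {a, b} = {x. x = (x \<bullet> a / (a \<bullet> a)) *\<^sub>R a + (x \<bullet> b / (b \<bullet> b)) *\<^sub>R b}"
    using * by blast
  also have "closed \<dots>"
    by (cases "a = 0"; cases "b = 0") (auto intro!: closed_Collect_eq continuous_intros)
  finally show ?thesis .
qed

section \<open>Lower bound: the hard quadratic\<close>

text \<open>
  In the units of the header, \<open>\<xi>\<close>, \<open>\<eta>\<close> and \<open>y\<^sub>1\<close>, \<open>y\<^sub>2\<close> are the coordinates of \<open>x - w\<close> and \<open>y - w\<close>
  along \<open>e\<close>, \<open>b\<close>, and the two sides are the potentials at \<open>(x0, y0)\<close> and at \<open>(x, y)\<close>.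
\<close>

lemma lower_bound_arith:
  fixes s t \<xi> \<eta> y\<^sub>1 y\<^sub>2 :: real
  assumes s: "10 \<le> s" and t: "0 \<le> t" "t \<le> 1"
  defines "m \<equiv> s\<^sup>2 - s" and "b \<equiv> s * (s - 1)\<^sup>2 - s\<^sup>2 * t\<^sup>2"
  shows "(1 - 1 / s - 100 / s\<^sup>2) * (t\<^sup>2 + (s * t * t)\<^sup>2 / m + s * t\<^sup>2 + s ^ 3 + s\<^sup>2 + b)
    \<le> 2 * s\<^sup>2 * \<xi> + \<xi>\<^sup>2 + \<eta>\<^sup>2 + (s * t * \<eta> - m * \<xi>)\<^sup>2 / m + s * \<eta>\<^sup>2 + s ^ 3
      + ((y\<^sub>1 + s)\<^sup>2 + (y\<^sub>2 + s * t)\<^sup>2 + b)"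
    (is "?\<rho> * ?D \<le> ?N")
proof -
  have m: "0 < m" "m = s * (s - 1)" using s by (auto simp: m_def power2_eq_square algebra_simps)
  have t2: "t\<^sup>2 \<le> 1" "0 \<le> t\<^sup>2" using t by (auto simp: power_le_one)
  have "10 * s \<le> s * s" using s by simp
  then have ss: "4 * s \<le> s * s" using s by linarith
  define \<omega> where "\<omega> = s * t * \<eta> - m * \<xi>"
  \<comment> \<open>Substituting \<open>\<omega>\<close> for \<open>\<xi>\<close> and completing
    squares minimizes over all \<open>x\<close> at once; the remaining squares
    \<open>\<xi>\<^sup>2\<close> and \<open>\<eta>\<^sup>2\<close> are simply dropped later.\<close>
  have "2 * s\<^sup>2 * \<xi> + \<omega>\<^sup>2 / m + s * \<eta>\<^sup>2
      = (\<omega> - s\<^sup>2)\<^sup>2 / m + s * (\<eta> + s\<^sup>2 * t / m)\<^sup>2 - s ^ 4 / m - s ^ 5 * t\<^sup>2 / m\<^sup>2"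
  proof -
    have \<xi>: "\<xi> = (s * t * \<eta> - \<omega>) / m"
      using m(1) by (simp add: \<omega>_def)
    show ?thesis
      unfolding \<xi> using m(1) by (simp add: field_simps power2_eq_square power3_eq_cube eval_nat_numeral)
  qed
  moreover have "0 \<le> (\<omega> - s\<^sup>2)\<^sup>2 / m" "0 \<le> s * (\<eta> + s\<^sup>2 * t / m)\<^sup>2"
    using m s by simp_all
  moreover have "s ^ 4 / m \<le> s\<^sup>2 + s + 2"
  proof -
    have "s ^ 4 \<le> (s\<^sup>2 + s + 2) * m"
      using s unfolding m(2) by (simp add: algebra_simps power2_eq_square eval_nat_numeral)
    then show ?thesis using m(1) by (simp add: divide_le_eq)
  qed
  moreover have "s ^ 5 * t\<^sup>2 / m\<^sup>2 \<le> 2 * s"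
  proof -
    have "s\<^sup>2 \<le> 2 * (s - 1)\<^sup>2"
      using ss by (simp add: power2_eq_square algebra_simps)
    then have "s ^ 3 * s\<^sup>2 \<le> s ^ 3 * (2 * (s - 1)\<^sup>2)"
      using s by (intro mult_left_mono) auto
    also have "\<dots> = 2 * s * m\<^sup>2"
      by (simp add: m(2) power_mult_distrib eval_nat_numeral)
    finally have "s ^ 5 \<le> 2 * s * m\<^sup>2"
      by (simp add: eval_nat_numeral mult.assoc)
    moreover have "s ^ 5 * t\<^sup>2 \<le> s ^ 5 * 1"
      using t2 s by (intro mult_left_mono) auto
    ultimately show ?thesis using m(1) by (simp add: divide_le_eq)
  qed
  moreover have "0 \<le> \<xi>\<^sup>2" "0 \<le> \<eta>\<^sup>2" "0 \<le> (y\<^sub>1 + s)\<^sup>2" "0 \<le> (y\<^sub>2 + s * t)\<^sup>2" by simp_all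
  ultimately have N: "s ^ 3 + b - s\<^sup>2 - 3 * s - 2 \<le> ?N"
    unfolding \<omega>_def by linarith
  have "(s * t * t)\<^sup>2 / m \<le> 2"
  proof -
    have "(s * t * t)\<^sup>2 \<le> s\<^sup>2 * 1"
      using t2 mult_le_one[of "t\<^sup>2" "t\<^sup>2"] s
      by (simp add: power_mult_distrib power2_eq_square mult.assoc mult_left_mono)
    also have "\<dots> \<le> 2 * m"
      using ss s unfolding m(2) by (simp add: power2_eq_square algebra_simps)
    finally show ?thesis using m(1) by (simp add: divide_le_eq)
  qed
  moreover have "s * t\<^sup>2 \<le> s * 1" using t2 s by (intro mult_left_mono) auto
  \<comment> \<open>Together with \<open>N\<close>, this bounds the loss \<open>?D - ?N\<close> by
    \<open>2 * s\<^sup>2 + 4 * s + 5\<close>.\<close>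
  ultimately have D_le: "?D \<le> s ^ 3 + s\<^sup>2 + b + s + 3"
    using t2 by linarith
  have "0 \<le> (s * t * t)\<^sup>2 / m" "0 \<le> s * t\<^sup>2" using m s by simp_all
  moreover have "s ^ 3 - 3 * s\<^sup>2 + s \<le> b"
  proof -
    have "s\<^sup>2 * t\<^sup>2 \<le> s\<^sup>2 * 1" using t2 by (intro mult_left_mono) auto
    then show ?thesis by (simp add: b_def power2_eq_square power3_eq_cube algebra_simps)
  qed
  ultimately have D_ge: "2 * s ^ 3 - 2 * s\<^sup>2 \<le> ?D"
    using t2 s by linarith
  \<comment> \<open>Since \<open>?D\<close> is at least \<open>2 * s ^ 3 - 2 * s\<^sup>2\<close>,
    the factor \<open>1 / s\<close> covers the leading term \<open>2 * s\<^sup>2\<close> of the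
    loss, and the \<open>100 / s\<^sup>2\<close> covers the linear remainder with room to
    spare.\<close>
  have "2 * s\<^sup>2 + 4 * s + 5 \<le> (1 / s + 100 / s\<^sup>2) * (2 * s ^ 3 - 2 * s\<^sup>2)"
  proof -
    have "(1 / s + 100 / s\<^sup>2) * (2 * s ^ 3 - 2 * s\<^sup>2) = 2 * s\<^sup>2 - 2 * s + 200 * s - 200"
      using s by (simp add: field_simps power2_eq_square power3_eq_cube)
    then show ?thesis using s by simp
  qed
  also have "\<dots> \<le> (1 / s + 100 / s\<^sup>2) * ?D"
    using s by (intro mult_left_mono D_ge) simp
  finally have "2 * s\<^sup>2 + 4 * s + 5 \<le> (1 / s + 100 / s\<^sup>2) * ?D" .
  moreover have "?\<rho> * ?D = ?D - (1 / s + 100 / s\<^sup>2) * ?D"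
    by (simp only: left_diff_distrib distrib_right mult_1 diff_diff_eq)
  ultimately show ?thesis using N D_le by linarith
qed

lemma inner_orthonormal3:
  fixes e b u :: "'a :: real_inner"
  assumes "norm e = 1" "norm b = 1" "norm u = 1" "e \<bullet> b = 0" "e \<bullet> u = 0" "b \<bullet> u = 0"
  shows "(x\<^sub>1 *\<^sub>R e + x\<^sub>2 *\<^sub>R b + x\<^sub>3 *\<^sub>R u) \<bullet> (y\<^sub>1 *\<^sub>R e + y\<^sub>2 *\<^sub>R b + y\<^sub>3 *\<^sub>R u) = x\<^sub>1 * y\<^sub>1 + x\<^sub>2 * y\<^sub>2 + x\<^sub>3 * y\<^sub>3"
proof -
  have "e \<bullet> e = 1" "b \<bullet> b = 1" "u \<bullet> u = 1" "b \<bullet> e = 0" "u \<bullet> e = 0" "u \<bullet> b = 0"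
    using assms by (simp_all add: norm_eq_1 inner_commute)
  then show ?thesis
    using assms(4-6) by (simp add: inner_add_left inner_add_right)
qed

text \<open>Here \<open>a\<close> stands for \<open>norm g / L\<close> and \<open>t\<close> for
  \<open>norm (x0 - w) / a\<close>. The function is chosen before the coordinates of
  \<open>x\<close> and \<open>y\<close>, so it is bad for all points of \<open>M\<close>
  simultaneously.\<close>

lemma hard_function:
  fixes s t a l :: real
  assumes s: "10 \<le> s" and t: "0 \<le> t" "t \<le> 1" and a: "0 < a" and l: "0 < l"
    and mem: "w \<in> Rn n" "e \<in> Rn n" "b \<in> Rn n" "u \<in> Rn n"
    and orthonormal: "norm e = 1" "norm b = 1" "norm u = 1" "e \<bullet> b = 0" "e \<bullet> u = 0" "b \<bullet> u = 0"
  shows "\<exists>f\<in>admissible n l (l * s\<^sup>2) w ((l * s\<^sup>2 * a) *\<^sub>R e). \<forall>\<xi> \<eta> y\<^sub>1 y\<^sub>2.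
    (1 - 1 / s - 100 / s\<^sup>2) * potential n l f (w + (a * t) *\<^sub>R b) (w - (s * (a * t)) *\<^sub>R b)
      \<le> potential n l f (w + \<xi> *\<^sub>R e + \<eta> *\<^sub>R b) (w + y\<^sub>1 *\<^sub>R e + y\<^sub>2 *\<^sub>R b)"
proof -
  define V where "V x y z = x *\<^sub>R e + y *\<^sub>R b + z *\<^sub>R u" for x y z :: real
  have V_mem: "V x y z \<in> Rn n" for x y z
    unfolding V_def by (intro subspace_add subspace_scale subspace_Rn mem)
  have inner_V: "V x\<^sub>1 x\<^sub>2 x\<^sub>3 \<bullet> V y\<^sub>1 y\<^sub>2 y\<^sub>3 = x\<^sub>1 * y\<^sub>1 + x\<^sub>2 * y\<^sub>2 + x\<^sub>3 * y\<^sub>3" for x\<^sub>1 x\<^sub>2 x\<^sub>3 y\<^sub>1 y\<^sub>2 y\<^sub>3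
    unfolding V_def by (rule inner_orthonormal3[OF orthonormal])
  have norm_V: "(norm (V x y z))\<^sup>2 = x\<^sup>2 + y\<^sup>2 + z\<^sup>2" for x y z
    by (simp only: power2_norm_eq_inner inner_V) (simp add: power2_eq_square)
  have V_diff: "(w + V x\<^sub>1 x\<^sub>2 x\<^sub>3) - (w + V y\<^sub>1 y\<^sub>2 y\<^sub>3) = V (x\<^sub>1 - y\<^sub>1) (x\<^sub>2 - y\<^sub>2) (x\<^sub>3 - y\<^sub>3)"
    for x\<^sub>1 x\<^sub>2 x\<^sub>3 y\<^sub>1 y\<^sub>2 y\<^sub>3
    by (simp add: V_def algebra_simps)
  have V_add: "V x\<^sub>1 x\<^sub>2 x\<^sub>3 + V y\<^sub>1 y\<^sub>2 y\<^sub>3 = V (x\<^sub>1 + y\<^sub>1) (x\<^sub>2 + y\<^sub>2) (x\<^sub>3 + y\<^sub>3)"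
    for x\<^sub>1 x\<^sub>2 x\<^sub>3 y\<^sub>1 y\<^sub>2 y\<^sub>3
    by (simp add: V_def algebra_simps)
  have V_scale: "c *\<^sub>R V x y z = V (c * x) (c * y) (c * z)" for c x y z
    by (simp add: V_def algebra_simps)
  \<comment> \<open>In units of \<open>a\<close>, a zero gradient at \<open>z\<close> requires the
    rank-one term to cancel \<open>g / l + (z - w)\<close>, whose coordinates are \<open>m\<close>,
    \<open>- (s * t)\<close>, \<open>\<beta>\<close>; hence the direction \<open>d\<close>. The
    value of \<open>B\<close> makes the eigenvalue along \<open>d\<close> exactly \<open>L\<close>
    and gives \<open>d \<bullet> (z - w) = a * m\<close>, matching the coefficient
    \<open>l / m\<close>.\<close>
  define m where "m = s\<^sup>2 - s"
  define B where "B = s * (s - 1)\<^sup>2 - s\<^sup>2 * t\<^sup>2"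
  define \<beta> where "\<beta> = sqrt B"
  have m: "0 < m" "m = s * (s - 1)" using s by (auto simp: m_def power2_eq_square algebra_simps)
  have ss: "10 * s \<le> s * s" using s by simp
  have t2: "t\<^sup>2 \<le> 1" "0 \<le> t\<^sup>2" using t by (auto simp: power_le_one)
  have B_ge: "s * (s\<^sup>2 - 3 * s + 1) \<le> B"
  proof -
    have "s\<^sup>2 * t\<^sup>2 \<le> s\<^sup>2 * 1" using t2 by (intro mult_left_mono) auto
    then show ?thesis by (simp add: B_def power2_eq_square power3_eq_cube algebra_simps)
  qed
  have "0 < s\<^sup>2 - 3 * s + 1" unfolding power2_eq_square using ss s by linarith
  then have B: "0 < B" using B_ge s by (meson less_le_trans mult_pos_pos order_less_le_trans zero_less_numeral)
  then have \<beta>: "\<beta>\<^sup>2 = B" "\<beta> * \<beta> = B" "0 < \<beta>" by (auto simp: \<beta>_def)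
  define g where "g = V (l * s\<^sup>2 * a) 0 0"
  define d where "d = V (- m) (s * t) (- \<beta>)"
  \<comment> \<open>Orthogonal to \<open>d\<close> and to \<open>z - w\<close>, so the second term
    leaves the minimizer untouched. With coefficient \<open>l * s / B\<close> it adds
    \<open>l * s / 2\<close> times the squared \<open>b\<close>-coordinate to \<open>f\<close> at
    points of \<open>M\<close>.\<close>
  define r where "r = V 0 \<beta> (s * t)"
  define f where "f = quadratic l w g (l / m) d (l * s / B) r"
  define G where "G = quadratic_grad l w g (l / m) d (l * s / B) r"
  define z where "z = w + V (- (a * s)) (- (a * s * t)) (a * \<beta>)"
  have norm_d: "m\<^sup>2 + (s * t)\<^sup>2 + B = m * (s\<^sup>2 - 1)"
    by (simp add: m_def B_def power2_eq_square algebra_simps)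
  interpret strongly_convex_smooth n l "l * s\<^sup>2" f G
    unfolding f_def G_def
  proof (rule strongly_convex_smooth_quadratic)
    show "l \<le> l * s\<^sup>2" using l s by simp
    show "d \<bullet> r = 0" unfolding d_def r_def inner_V by simp
    show "0 \<le> l / m" "0 \<le> l * s / B" using l m B s by simp_all
    have "(norm d)\<^sup>2 = m * (s\<^sup>2 - 1)"
      unfolding d_def norm_V norm_d[symmetric] by (simp add: \<beta>)
    then show "l / m * (norm d)\<^sup>2 \<le> l * s\<^sup>2 - l"
      using m(1) by (simp add: right_diff_distrib)
    \<comment> \<open>The eigenvalue excess along \<open>r\<close> is only of order
      \<open>l * s\<close>; the lower bound on \<open>B\<close> and \<open>10 \<le> s\<close> keep
      it within \<open>L - l\<close>.\<close>
    have "(B + (s * t)\<^sup>2) * s = s\<^sup>2 * (s - 1)\<^sup>2"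
      by (simp add: B_def power2_eq_square algebra_simps)
    also have "\<dots> \<le> (s * (s\<^sup>2 - 3 * s + 1)) * (s\<^sup>2 - 1)"
    proof -
      have "s * (s - 1) \<le> (s\<^sup>2 - 3 * s + 1) * (s + 1)"
      proof -
        have "10 * (s * s) \<le> s * (s * s)" using s by simp
        then have "s + 3 * (s * s) \<le> 1 + s * (s * s)" using ss s by linarith
        then show ?thesis by (simp add: power2_eq_square algebra_simps)
      qed
      then have "s * (s - 1) * (s * (s - 1)) \<le> (s\<^sup>2 - 3 * s + 1) * (s + 1) * (s * (s - 1))"
        using s by (intro mult_right_mono) auto
      then show ?thesis by (simp add: power2_eq_square algebra_simps)
    qed
    also have "\<dots> \<le> B * (s\<^sup>2 - 1)"
      using B_ge s by (intro mult_right_mono) auto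
    finally have "l * ((B + (s * t)\<^sup>2) * s) / B \<le> l * (B * (s\<^sup>2 - 1)) / B"
      using l B by (intro divide_right_mono mult_left_mono) auto
    moreover have "l * s / B * (norm r)\<^sup>2 = l * ((B + (s * t)\<^sup>2) * s) / B"
      unfolding r_def norm_V \<beta> by (simp add: ac_simps)
    moreover have "l * (B * (s\<^sup>2 - 1)) / B = l * s\<^sup>2 - l"
      using B by (simp add: field_simps)
    ultimately show "l * s / B * (norm r)\<^sup>2 \<le> l * s\<^sup>2 - l"
      by linarith
  qed (use l V_mem mem in \<open>simp_all add: g_def d_def r_def\<close>)
  have f_adm: "f \<in> admissible n l (l * s\<^sup>2) w ((l * s\<^sup>2 * a) *\<^sub>R e)"
    by (rule f_admissible) (simp add: G_def quadratic_grad_centre g_def V_def)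
  have f_V: "f (w + V x y v) = l * (s\<^sup>2 * a * x + (x\<^sup>2 + y\<^sup>2 + v\<^sup>2) / 2
      + (s * t * y - m * x - \<beta> * v)\<^sup>2 / (2 * m) + s * (\<beta> * y + s * t * v)\<^sup>2 / (2 * B))" for x y v
    unfolding f_def quadratic_def g_def d_def r_def
    by (simp add: inner_V) (simp add: power2_eq_square algebra_simps add_divide_distrib diff_divide_distrib)
  have d_z: "d \<bullet> (z - w) = a * m"
  proof -
    have "d \<bullet> (z - w) = a * (m * s - (s * t)\<^sup>2 - B)"
      by (simp add: d_def z_def inner_V \<beta> power2_eq_square algebra_simps)
    also have "m * s - (s * t)\<^sup>2 - B = m"
      by (simp add: m_def B_def power2_eq_square algebra_simps)
    finally show ?thesis .
  qed
  have r_z: "r \<bullet> (z - w) = 0"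
    by (simp add: r_def z_def inner_V)
  have z_min: "arg_min_on f (Rn n) = z"
  proof (rule minimizer_eqI)
    show "z \<in> Rn n"
      unfolding z_def by (intro subspace_add subspace_Rn mem V_mem)
    have "G z = g + l *\<^sub>R (z - w) + (l * a) *\<^sub>R d"
      using m(1) by (simp add: G_def quadratic_grad_def d_z r_z)
    also have "\<dots> = V 0 0 0"
      unfolding g_def z_def d_def by (simp add: V_add V_scale m_def) (simp add: power2_eq_square algebra_simps)
    finally show "G z = 0" by (simp add: V_def)
  qed
  have f_z: "f z = - (l * a\<^sup>2 * s ^ 3 / 2)"
  proof -
    have zw: "(z - w) \<bullet> (z - w) = a\<^sup>2 * (s\<^sup>2 + (s * t)\<^sup>2 + B)"
      by (simp add: z_def inner_V \<beta> power2_eq_square algebra_simps)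
    have "f z = l * (- (s ^ 3 * a\<^sup>2) + a\<^sup>2 * (s\<^sup>2 + (s * t)\<^sup>2 + B + m) / 2)"
      unfolding f_def quadratic_def zw d_z r_z using m(1)
      by (simp add: z_def g_def inner_V power2_eq_square power3_eq_cube algebra_simps add_divide_distrib)
    also have "s\<^sup>2 + (s * t)\<^sup>2 + B + m = s ^ 3"
      by (simp add: m_def B_def power2_eq_square power3_eq_cube algebra_simps)
    finally show ?thesis by (simp add: algebra_simps)
  qed
  have pot: "potential n l f (w + V (a * \<xi>) (a * \<eta>) 0) (w + V (a * y\<^sub>1) (a * y\<^sub>2) 0)
      = a\<^sup>2 * (2 * s\<^sup>2 * \<xi> + \<xi>\<^sup>2 + \<eta>\<^sup>2 + (s * t * \<eta> - m * \<xi>)\<^sup>2 / m + s * \<eta>\<^sup>2 + s ^ 3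
        + ((y\<^sub>1 + s)\<^sup>2 + (y\<^sub>2 + s * t)\<^sup>2 + B))" for \<xi> \<eta> y\<^sub>1 y\<^sub>2
  proof -
    have "f (w + V (a * \<xi>) (a * \<eta>) 0)
        = l * a\<^sup>2 / 2 * (2 * s\<^sup>2 * \<xi> + \<xi>\<^sup>2 + \<eta>\<^sup>2 + (s * t * \<eta> - m * \<xi>)\<^sup>2 / m + s * \<eta>\<^sup>2)"
    proof -
      have 1: "s * (\<beta> * (a * \<eta>) + s * t * 0)\<^sup>2 / (2 * B) = a\<^sup>2 * (s * \<eta>\<^sup>2) / 2"
        using B by (simp add: power_mult_distrib \<beta>)
      have 2: "(s * t * (a * \<eta>) - m * (a * \<xi>) - \<beta> * 0)\<^sup>2 = a\<^sup>2 * (s * t * \<eta> - m * \<xi>)\<^sup>2"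
        by (simp add: power2_eq_square algebra_simps)
      have 3: "(a * \<xi>)\<^sup>2 = a\<^sup>2 * \<xi>\<^sup>2" "(a * \<eta>)\<^sup>2 = a\<^sup>2 * \<eta>\<^sup>2" "s\<^sup>2 * a * (a * \<xi>) = a\<^sup>2 * (s\<^sup>2 * \<xi>)"
        by (simp_all add: power2_eq_square)
      show ?thesis
        unfolding f_V 1 2 3 by (simp add: distrib_left add_divide_distrib mult.assoc)
    qed
    then have "2 / l * (f (w + V (a * \<xi>) (a * \<eta>) 0) - f z)
        = a\<^sup>2 * (2 * s\<^sup>2 * \<xi> + \<xi>\<^sup>2 + \<eta>\<^sup>2 + (s * t * \<eta> - m * \<xi>)\<^sup>2 / m + s * \<eta>\<^sup>2 + s ^ 3)"
      unfolding f_z using l by (simp add: distrib_left)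
    moreover have "(norm ((w + V (a * y\<^sub>1) (a * y\<^sub>2) 0) - z))\<^sup>2 = a\<^sup>2 * ((y\<^sub>1 + s)\<^sup>2 + (y\<^sub>2 + s * t)\<^sup>2 + B)"
      unfolding z_def V_diff norm_V using \<beta> by (simp add: power2_eq_square algebra_simps)
    ultimately show ?thesis
      unfolding potential_eq z_min by (simp only: distrib_left)
  qed
  \<comment> \<open>The \<open>b\<close>-coordinate of \<open>y0\<close> equals that of the
    minimizer, so the distance part of the potential reduces to
    \<open>s\<^sup>2 + B\<close>.\<close>
  have start: "potential n l f (w + (a * t) *\<^sub>R b) (w - (s * (a * t)) *\<^sub>R b)
      = a\<^sup>2 * (t\<^sup>2 + (s * t * t)\<^sup>2 / m + s * t\<^sup>2 + s ^ 3 + s\<^sup>2 + B)"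
    using pot[of 0 t 0 "- (s * t)"] by (simp add: V_def mult.left_commute[of a s])
  have "(1 - 1 / s - 100 / s\<^sup>2) * potential n l f (w + (a * t) *\<^sub>R b) (w - (s * (a * t)) *\<^sub>R b)
      \<le> potential n l f (w + \<xi> *\<^sub>R e + \<eta> *\<^sub>R b) (w + y\<^sub>1 *\<^sub>R e + y\<^sub>2 *\<^sub>R b)" for \<xi> \<eta> y\<^sub>1 y\<^sub>2
  proof -
    have *: "w + x *\<^sub>R e + y *\<^sub>R b = w + V (a * (x / a)) (a * (y / a)) 0" for x y
      using a by (simp add: V_def)
    show ?thesis
      unfolding start * pot mult.left_commute[of _ "a\<^sup>2"]
      by (intro mult_left_mono lower_bound_arith[OF s t, folded m_def B_def]) simp
  qed
  then show ?thesis using f_adm by blast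
qed

section \<open>Bounds on the worst ratio and conclusion\<close>

lemma worst_ratio_accelerated_le:
  assumes l: "0 < l" and s: "1 < s" and L: "L = l * s\<^sup>2"
    and x0: "x0 \<in> Rn n" and w: "w \<in> Rn n" and y0: "y0 = w - s *\<^sub>R (x0 - w)"
    and g: "g \<noteq> 0" "(x0 - w) \<bullet> g = 0"
    and x1: "x1 = w - (1 / L) *\<^sub>R g" and y1: "y1 = x1 + (s - 1) *\<^sub>R (x1 - x0)"
  shows "worst_ratio n l L w g x0 y0 x1 y1 \<le> ereal (1 - 1 / s)"
  unfolding worst_ratio_def
proof (rule SUP_least)
  fix f assume f: "f \<in> admissible n l L w g"
  have L0: "0 < L" using l s L by simp
  obtain G where G: "strongly_convex_smooth n l L f G" "G w = g"
    using admissibleE[OF f l L0] .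
  have "potential n l f x1 y1 \<le> (1 - 1 / s) * potential n l f x0 y0"
    using strongly_convex_smooth.accelerated_step[OF G(1) x0 w L _ y0 _ _ y1] s g x1 G(2) by simp
  moreover have "0 < potential n l f x0 y0"
    using potential_pos[OF f l L0 g(1) x0 y0] s by simp
  ultimately show "ereal (potential n l f x1 y1 / potential n l f x0 y0) \<le> ereal (1 - 1 / s)"
    by (simp add: divide_le_eq)
qed

lemma worst_ratio_ge:
  assumes n: "3 \<le> n" and l: "0 < l" and s: "1 < s" and L: "L = l * s\<^sup>2"
    and mem: "x0 \<in> Rn n" "w \<in> Rn n" "g \<in> Rn n" and y0: "y0 = w - s *\<^sub>R (x0 - w)"
    and g: "g \<noteq> 0" "(x0 - w) \<bullet> g = 0" "norm (x0 - w) \<le> norm g / L"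
    and xy: "x - w \<in> span {g, x0 - w}" "y - w \<in> span {g, x0 - w}"
  shows "ereal (1 - 1 / s - 100 / s\<^sup>2) \<le> worst_ratio n l L w g x0 y0 x y"
proof -
  have L0: "0 < L" using l s L by simp
  have p: "x0 - w \<in> Rn n" by (intro subspace_diff subspace_Rn mem)
  have pos: "0 < potential n l f x0 y0" if "f \<in> admissible n l L w g" for f
    using potential_pos[OF that l L0 g(1) mem(1) y0] s by simp
  have "\<exists>f\<in>admissible n l L w g.
      (1 - 1 / s - 100 / s\<^sup>2) * potential n l f x0 y0 \<le> potential n l f x y"
  proof (cases "10 \<le> s")
    \<comment> \<open>For \<open>s\<close> below 10 the claimed factor is nonpositive because 100 is
      the square of 10; any admissible function then works, its potentials being
      nonnegative.\<close>
    case False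
    then have "s\<^sup>2 \<le> 10\<^sup>2" using s by (intro power_mono) auto
    then have "1 \<le> 100 / s\<^sup>2" using s by (simp add: le_divide_eq)
    moreover have "0 < 1 / s" using s by simp
    ultimately have le: "1 - 1 / s - 100 / s\<^sup>2 \<le> 0" by linarith
    have "l \<le> L" using l s L by simp
    then obtain f where f: "f \<in> admissible n l L w g"
      using admissible_nonempty[OF l _ mem(2,3)] by blast
    obtain G where G: "strongly_convex_smooth n l L f G"
      using admissibleE[OF f l L0] .
    obtain \<alpha> \<beta> where "x = w + (\<alpha> *\<^sub>R g + \<beta> *\<^sub>R (x0 - w))"
      using xy(1) by (metis in_span_pair_iff add_diff_cancel_left' diff_add_cancel add.commute)
    then have "x \<in> Rn n"
      by (simp add: subspace_add subspace_scale subspace_Rn mem p)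
    have "(1 - 1 / s - 100 / s\<^sup>2) * potential n l f x0 y0 \<le> 0"
      using le pos[OF f] by (intro mult_nonpos_nonneg) auto
    also have "0 \<le> potential n l f x y"
      by (rule order_trans[OF _ strongly_convex_smooth.potential_ge[OF G \<open>x \<in> Rn n\<close>]]) simp
    finally show ?thesis using f by blast
  next
    case True
    define a where "a = norm g / L"
    define e where "e = g /\<^sub>R norm g"
    define t where "t = norm (x0 - w) / a"
    have a: "0 < a" using g L0 by (simp add: a_def)
    have ge: "g = (l * s\<^sup>2 * a) *\<^sub>R e"
      using g L0 by (simp add: a_def e_def flip: L)
    have e: "e \<in> Rn n" "norm e = 1"
      using g by (simp_all add: e_def subspace_scale subspace_Rn mem)
    have t: "0 \<le> t" "t \<le> 1"
      using a g(3) by (simp_all add: t_def a_def[symmetric])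
    obtain b where b: "b \<in> Rn n" "norm b = 1" "e \<bullet> b = 0" "x0 - w = (a * t) *\<^sub>R b"
    proof (cases "x0 = w")
      \<comment> \<open>Here \<open>t = 0\<close>, and any unit vector orthogonal to
        \<open>e\<close> can serve as \<open>b\<close>.\<close>
      case True
      obtain b where "b \<in> Rn n" "norm b = 1" "b \<bullet> e = 0"
        using exists_orthogonal_unit_Rn[OF n e(1) e(1)] .
      then show ?thesis using True by (intro that[of b]) (auto simp: t_def inner_commute)
    next
      case False
      then show ?thesis
        using a p g(2) by (intro that[of "(x0 - w) /\<^sub>R norm (x0 - w)"])
          (auto simp: t_def e_def subspace_scale subspace_Rn inner_commute)
    qed
    obtain u where u: "u \<in> Rn n" "norm u = 1" "u \<bullet> e = 0" "u \<bullet> b = 0"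
      using exists_orthogonal_unit_Rn[OF n e(1) b(1)] .
    have coords: "\<exists>\<xi> \<eta>. v = w + \<xi> *\<^sub>R e + \<eta> *\<^sub>R b" if v: "v - w \<in> span {g, x0 - w}" for v
    proof -
      obtain \<alpha> \<beta> where "v - w = \<alpha> *\<^sub>R g + \<beta> *\<^sub>R (x0 - w)"
        using v in_span_pair_iff by blast
      then have "v = w + (\<alpha> * (l * s\<^sup>2 * a)) *\<^sub>R e + (\<beta> * (a * t)) *\<^sub>R b"
        unfolding b(4) ge by (simp add: algebra_simps)
      then show ?thesis by blast
    qed
    obtain \<xi> \<eta> y\<^sub>1 y\<^sub>2 where xy_eq: "x = w + \<xi> *\<^sub>R e + \<eta> *\<^sub>R b" "y = w + y\<^sub>1 *\<^sub>R e + y\<^sub>2 *\<^sub>R b"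
      using coords[OF xy(1)] coords[OF xy(2)] by blast
    have start_eq: "x0 = w + (a * t) *\<^sub>R b" "y0 = w - (s * (a * t)) *\<^sub>R b"
      using b(4) y0 by (simp_all add: algebra_simps)
    have "e \<bullet> u = 0" "b \<bullet> u = 0"
      using u(3,4) by (simp_all add: inner_commute)
    from hard_function[OF True t a l mem(2) e(1) b(1) u(1) e(2) b(2) u(2) b(3) this, folded ge L]
    show ?thesis
      unfolding xy_eq start_eq by blast
  qed
  then obtain f where f: "f \<in> admissible n l L w g"
    "(1 - 1 / s - 100 / s\<^sup>2) * potential n l f x0 y0 \<le> potential n l f x y" by blast
  have "ereal (1 - 1 / s - 100 / s\<^sup>2) \<le> ereal (potential n l f x y / potential n l f x0 y0)"
    using f pos[OF f(1)] by (simp add: le_divide_eq)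
  also have "\<dots> \<le> worst_ratio n l L w g x0 y0 x y"
    unfolding worst_ratio_def using f(1) by (rule SUP_upper)
  finally show ?thesis .
qed

lemma accelerated_gradient_near_optimal:
  fixes x0 y0 g :: finseq and l L \<kappa> :: real
  assumes n: "3 \<le> n" and x0: "x0 \<in> Rn n" and y0: "y0 \<in> Rn n" and g: "g \<in> Rn n" "g \<noteq> 0"
    and l: "0 < l" and lL: "l < L" and \<kappa>: "\<kappa> = L / l"
    and w_eq: "w = (sqrt \<kappa> / (sqrt \<kappa> + 1)) *\<^sub>R x0 + (1 / (sqrt \<kappa> + 1)) *\<^sub>R y0"
    and small: "norm (x0 - w) \<le> norm g / L" and orth: "(x0 - w) \<bullet> g = 0"
    and M_eq: "M = (\<lambda>v. w + v) ` span {g, x0 - y0}"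
    and x1: "x1 = w - (1 / L) *\<^sub>R g"
    and y1: "y1 = x1 + (sqrt \<kappa> - 1) *\<^sub>R (x1 - x0)"
  shows "x1 \<in> M \<and> y1 \<in> M \<and>
    worst_ratio n l L w g x0 y0 x1 y1 \<le> ereal (1 - \<kappa> powr (- 1 / 2)) \<and>
    (\<exists>xm\<in>M. \<exists>ym\<in>M.
       (\<forall>x\<in>M. \<forall>y\<in>M. worst_ratio n l L w g x0 y0 xm ym \<le> worst_ratio n l L w g x0 y0 x y) \<and>
       ereal (1 - \<kappa> powr (- 1 / 2) - 100 * \<kappa> powr (- 1)) \<le> worst_ratio n l L w g x0 y0 xm ym)"
proof -
  let ?q = "worst_ratio n l L w g x0 y0"
  define s where "s = sqrt \<kappa>"
  note w_eq = w_eq[folded s_def] and y1 = y1[folded s_def]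
  have \<kappa>_gt: "1 < \<kappa>" using l lL by (simp add: \<kappa>)
  then have s: "1 < s" by (simp add: s_def)
  have s2: "s\<^sup>2 = \<kappa>" using \<kappa>_gt by (simp add: s_def)
  then have L: "L = l * s\<^sup>2" using l by (simp add: \<kappa>)
  have powr: "\<kappa> powr (- 1 / 2) = 1 / s" "\<kappa> powr (- 1) = 1 / s\<^sup>2"
    using \<kappa>_gt by (simp_all add: s2 s_def powr_minus_divide powr_half_sqrt)
  have w: "w \<in> Rn n"
    unfolding w_eq by (intro subspace_add subspace_scale subspace_Rn x0 y0)
  \<comment> \<open>Solving the definition of \<open>w\<close> for \<open>y0\<close> puts
    \<open>x0\<close>, \<open>w\<close>, \<open>y0\<close> on one line, the form in which the data
    enter all the estimates.\<close>
  have "(s + 1) *\<^sub>R w = s *\<^sub>R x0 + y0"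
    using s by (simp add: w_eq scaleR_add_right)
  then have y0_eq: "y0 = w - s *\<^sub>R (x0 - w)"
    by (simp add: algebra_simps)
  then have diff: "x0 - y0 = (1 + s) *\<^sub>R (x0 - w)"
    by (simp add: algebra_simps)
  \<comment> \<open>Passing to the generator \<open>x0 - w\<close>, a nonzero multiple away, gives
    an orthogonal pair and hence closedness of \<open>M\<close>.\<close>
  have "span {g, x0 - y0} = span {g, x0 - w}"
  proof -
    have "\<beta> *\<^sub>R (x0 - w) = (\<beta> / (1 + s)) *\<^sub>R (x0 - y0)" for \<beta>
      using s by (simp add: diff)
    moreover have "\<beta> *\<^sub>R (x0 - y0) = (\<beta> * (1 + s)) *\<^sub>R (x0 - w)" for \<beta>
      by (simp add: diff)
    ultimately show ?thesis
      by (intro set_eqI) (metis in_span_pair_iff)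
  qed
  then have M: "M = (\<lambda>v. w + v) ` span {g, x0 - w}"
    by (simp add: M_eq)
  have "x1 = w + ((- (1 / L)) *\<^sub>R g + 0 *\<^sub>R (x0 - w))"
    by (simp add: x1)
  then have x1_M: "x1 \<in> M"
    unfolding M using in_span_pair_iff by blast
  have "y1 = w + ((- (s / L)) *\<^sub>R g + (1 - s) *\<^sub>R (x0 - w))"
    by (simp add: y1 x1 algebra_simps flip: scaleR_add_left) (simp add: diff_divide_distrib)
  then have y1_M: "y1 \<in> M"
    unfolding M using in_span_pair_iff by blast
  have M_Rn: "M \<subseteq> Rn n"
  proof -
    have "span {g, x0 - w} \<subseteq> Rn n"
      using g x0 w by (intro span_minimal subspace_Rn) (auto intro: subspace_diff subspace_Rn)
    then show ?thesis
      unfolding M using subspace_add[OF subspace_Rn w] by blast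
  qed
  have M_closed: "closed M"
    unfolding M using orth
    by (intro closed_translation closed_span_orthogonal_pair) (simp add: inner_commute)
  have upper: "?q x1 y1 \<le> ereal (1 - 1 / s)"
    by (rule worst_ratio_accelerated_le[OF l s L x0 w y0_eq g(2) orth x1 y1])
  have lower: "ereal (1 - 1 / s - 100 / s\<^sup>2) \<le> ?q x y" if "x \<in> M" "y \<in> M" for x y
    using that unfolding M
    by (intro worst_ratio_ge[OF n l s L x0 w g(1) y0_eq g(2) orth small]) auto
  have "\<exists>xm\<in>M. \<exists>ym\<in>M. \<forall>x\<in>M. \<forall>y\<in>M. ?q xm ym \<le> ?q x y"
  proof (rule worst_ratio_attains_min[OF l _ w g(1) _ M_closed M_Rn x1_M y1_M])
    show "l \<le> L" using lL by simp
    show "0 < potential n l f x0 y0" if "f \<in> admissible n l L w g" for f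
      using potential_pos[OF that l _ g(2) x0 y0_eq] l lL s by simp
    have "ereal (1 - 1 / s) \<le> 1" using s by (simp add: one_ereal_def)
    then show "?q x1 y1 \<le> 1" using upper by (rule order_trans[rotated])
  qed
  then show ?thesis
    using x1_M y1_M upper lower unfolding powr by auto
qed

theorem theorem12:
  shows "\<exists>C::real. \<forall>n\<ge>3. \<forall>x0\<in>Rn n. \<forall>y0\<in>Rn n. \<forall>g\<in>Rn n. \<forall>l L :: real.
    g \<noteq> 0 \<longrightarrow> 0 < l \<longrightarrow> l < L \<longrightarrow>
    (let \<kappa> = L / l;
         w = (sqrt \<kappa> / (sqrt \<kappa> + 1)) *\<^sub>R x0 + (1 / (sqrt \<kappa> + 1)) *\<^sub>R y0;
         q = worst_ratio n l L w g x0 y0;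
         M = (\<lambda>v. w + v) ` span {g, x0 - y0};
         x1 = w - (1 / L) *\<^sub>R g;
         y1 = x1 + (sqrt \<kappa> - 1) *\<^sub>R (x1 - x0)
     in norm (x0 - w) \<le> norm g / L \<longrightarrow> (x0 - w) \<bullet> g = 0 \<longrightarrow>
        x1 \<in> M \<and> y1 \<in> M \<and>
        q x1 y1 \<le> ereal (1 - \<kappa> powr (- 1 / 2)) \<and>
        (\<exists>xm\<in>M. \<exists>ym\<in>M.
           (\<forall>x\<in>M. \<forall>y\<in>M. q xm ym \<le> q x y) \<and>
           ereal (1 - \<kappa> powr (- 1 / 2) - C * \<kappa> powr (- 1)) \<le> q xm ym))"
  unfolding Let_def
  \<comment> \<open>The absolute constant 100 is the one fixed in \<open>hard_function\<close> and
    by the cutoff at \<open>s = 10\<close>.\<close>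
  by (intro exI[of _ 100] allI ballI impI, rule accelerated_gradient_near_optimal[OF _ _ _ _ _ _ _ refl refl _ _ refl refl refl])

end
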